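(* Let $G$ be a directed graph whose underlying undirected graph is either a star graph $K_{1,n}$ ($n\ge1$) or the complete graph $K_3$ on three vertices. Let $\mathfrak n_G$ be the associated metric 2-step nilpotent Lie algebra and let $N$ be the simply connected 2-step nilpotent Lie group with Lie algebra $\mathfrak n_G$, with the left invariant Riemannian metric determined by the inner product. Then there exists a lattice $\Gamma\subseteq N$ such that $\Gamma\backslash N$ has the density of closed geodesics property.
   Context: Construction of $\mathfrak{n}_G$: let $G=(S,E)$ be a finite simple directed graph with at least one edge, with vertex set $S=\{X_1,\dots,X_m\}$ and edge set $E=\{Z_1,\dots,Z_q\}$. Let $\mathcal V$ be the real vector space with basis $S$, $\mathfrak z$ the real vector space with basis $E$, and $\mathfrak n_G=\mathcal V\oplus\mathfrak z$. The Lie bracket is the bilinear skew-symmetric extension of: $[X_i,X_l]=Z_k$ if $Z_k$ is a directed edge from $X_i$ to $X_l$; $[X_i,X_l]=0$ if $X_i,X_l$ are not adjacent; and $[\mathfrak n_G,\mathfrak z]=0$. The inner product is the one making $S\cup E$ orthonormal. The star graph $K_{1,n}$ is the complete bipartite graph with parts of sizes $1$ and $n$. A lattice $\Gamma\subseteq N$ is a discrete cocompact subgroup; $\Gamma\backslash N$ carries the Riemannian metric induced by the left invariant metric on $N$. A compact Riemannian manifold $M$ has the density of closed geodesics property if the (unit) vectors tangent to smoothly closed geodesics are dense in the unit tangent bundle of $M$. *)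

theory Defs
  imports
    "HOL-Analysis.Analysis"
    "HOL-Algebra.Coset"
    "Graph_Theory.Kuratowski"
begin

section \<open>The metric Lie algebra and its simply connected group\<close>

text \<open>
  The locale \<^locale>\<open>digraph\<close> excludes loops and parallel arcs but still admits a pair of
  opposite arcs; the asymmetry condition excludes those.
\<close>

definition simple_digraph :: "('v, 'e) pre_digraph \<Rightarrow> bool" where
  "simple_digraph G \<longleftrightarrow> digraph G \<and> asym (arcs_ends G)"

text \<open>
  The graph is taken to use up its vertex type and its arc type, so that \<open>real ^ 'v\<close> and
  \<open>real ^ 'e\<close> are the spaces with bases \<open>S\<close> and \<open>E\<close>.  The standard inner product
  of the product space is the one that makes \<open>S \<union> E\<close> orthonormal.
\<close>

type_synonym ('v, 'e) graph_algebra = "(real ^ 'v) \<times> (real ^ 'e)"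

definition lie_bracket ::
  "('v::finite, 'e::finite) pre_digraph \<Rightarrow>
    ('v, 'e) graph_algebra \<Rightarrow> ('v, 'e) graph_algebra \<Rightarrow> ('v, 'e) graph_algebra" where
  "lie_bracket G x y =
    (0, \<chi> e. fst x $ tail G e * fst y $ head G e - fst x $ head G e * fst y $ tail G e)"

lemma bounded_bilinear_lie_bracket: "bounded_bilinear (lie_bracket G)"
proof -
  have "bilinear (lie_bracket G)"
    unfolding bilinear_def lie_bracket_def
    by (auto intro!: linearI simp: vec_eq_iff algebra_simps zero_prod_def)
  then show ?thesis
    by (simp add: bilinear_conv_bounded_bilinear)
qed

interpretation lie_bracket: bounded_bilinear "lie_bracket G"
  by (rule bounded_bilinear_lie_bracket)

lemma lie_bracket_skew: "lie_bracket G x y = - lie_bracket G y x"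
  by (simp add: lie_bracket_def vec_eq_iff)

lemma lie_bracket_nested [simp]:
  "lie_bracket G (lie_bracket G x y) z = 0" "lie_bracket G z (lie_bracket G x y) = 0"
  by (simp_all add: lie_bracket_def zero_prod_def vec_eq_iff)

lemma lie_bracket_self [simp]: "lie_bracket G x x = 0"
  by (simp add: lie_bracket_def zero_prod_def vec_eq_iff)

lemma lie_bracket_central: "lie_bracket G x (0, z) = 0"
  by (simp add: lie_bracket_def zero_prod_def vec_eq_iff)

lemma lie_bracket_arc:
  assumes "simple_digraph G" "arcs G = UNIV"
  shows "lie_bracket G (axis (tail G k) 1, 0) (axis (head G k) 1, 0) = (0, axis k 1)"
proof -
  interpret digraph G using assms(1) by (simp add: simple_digraph_def)
  have ends: "(tail G e, head G e) \<in> arcs_ends G" for e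
    using assms(2) by (auto simp: arcs_ends_def arc_to_ends_def)
  have 1: "e = k" if "tail G e = tail G k" "head G e = head G k" for e
    using that no_multi_arcs[of e k] assms(2) by (simp add: arc_to_ends_def)
  have 2: "\<not> (head G e = tail G k \<and> tail G e = head G k)" for e
    using ends[of e] ends[of k] assms(1) by (auto simp: simple_digraph_def dest: asymD)
  have 3: "tail G e \<noteq> head G e" for e
    using no_loops[of e] assms(2) by simp
  show ?thesis
    unfolding lie_bracket_def using 1 2 3
    by (auto simp: vec_eq_iff axis_def)
qed

lemma lie_bracket_nonadjacent:
  assumes "arcs G = UNIV" "(i, l) \<notin> arcs_ends G" "(l, i) \<notin> arcs_ends G"
  shows "lie_bracket G (axis i 1, 0) (axis l 1, 0) = 0"
  using assms
  by (auto simp: lie_bracket_def vec_eq_iff axis_def zero_prod_def arcs_ends_def arc_to_ends_def)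

text \<open>
  The simply connected Lie group with this Lie algebra, in exponential coordinates; for a 2-step
  nilpotent algebra the Baker--Campbell--Hausdorff formula stops after the first bracket.
\<close>

definition nil_group ::
  "('v::finite, 'e::finite) pre_digraph \<Rightarrow> ('v, 'e) graph_algebra monoid" where
  "nil_group G =
    \<lparr>carrier = UNIV, mult = (\<lambda>x y. x + y + (1/2) *\<^sub>R lie_bracket G x y), one = 0\<rparr>"

lemma mult_nil_group: "x \<otimes>\<^bsub>nil_group G\<^esub> y = x + y + (1/2) *\<^sub>R lie_bracket G x y"
  by (simp add: nil_group_def)

definition left_translation ::
  "('v::finite, 'e::finite) pre_digraph \<Rightarrow>
    ('v, 'e) graph_algebra \<Rightarrow> ('v, 'e) graph_algebra \<Rightarrow> ('v, 'e) graph_algebra" where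
  "left_translation G a = (\<lambda>x. a \<otimes>\<^bsub>nil_group G\<^esub> x)"

definition d_left_translation ::
  "('v::finite, 'e::finite) pre_digraph \<Rightarrow> ('v, 'e) graph_algebra \<Rightarrow>
    ('v, 'e) graph_algebra \<Rightarrow> ('v, 'e) graph_algebra \<Rightarrow> ('v, 'e) graph_algebra" where
  "d_left_translation G a p u = frechet_derivative (left_translation G a) (at p) u"

lemma group_nil_group: "group (nil_group G)"
proof (rule groupI)
  show "\<exists>y\<in>carrier (nil_group G). y \<otimes>\<^bsub>nil_group G\<^esub> x = \<one>\<^bsub>nil_group G\<^esub>" for x
    by (rule bexI[of _ "- x"]) (simp_all add: nil_group_def lie_bracket.minus_left)
qed (simp_all add: nil_group_def lie_bracket.add_left lie_bracket.add_right
      lie_bracket.scaleR_left lie_bracket.scaleR_right scaleR_add_right lie_bracket.zero_left)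

lemma inv_nil_group: "inv\<^bsub>nil_group G\<^esub> x = - x"
  by (rule group.inv_equality[OF group_nil_group])
     (simp_all add: nil_group_def lie_bracket.minus_left)

lemma d_left_translation: "d_left_translation G a p u = u + (1/2) *\<^sub>R lie_bracket G a u"
proof -
  have "(lie_bracket G a has_derivative lie_bracket G a) (at p)"
    by (rule bounded_linear_imp_has_derivative, rule lie_bracket.bounded_linear_right)
  then have "((\<lambda>x. a + x + (1/2) *\<^sub>R lie_bracket G a x) has_derivative
      (\<lambda>u. 0 + u + (1/2) *\<^sub>R lie_bracket G a u)) (at p)"
    by (intro has_derivative_add has_derivative_const has_derivative_ident
        has_derivative_scaleR_right)
  from frechet_derivative_at[OF this, symmetric] show ?thesis
    by (simp add: d_left_translation_def left_translation_def nil_group_def)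
qed

text \<open>
  The commutator at the identity of the left invariant vector fields through \<open>u\<close> and \<open>v\<close>
  is \<open>lie_bracket G u v\<close>: the Lie algebra of \<^const>\<open>nil_group\<close> is the one above.
\<close>

lemma lie_algebra_nil_group:
  "frechet_derivative (\<lambda>p. d_left_translation G p 0 v) (at 0) u
    - frechet_derivative (\<lambda>p. d_left_translation G p 0 u) (at 0) v = lie_bracket G u v"
proof -
  have "((\<lambda>p. w + (1/2) *\<^sub>R lie_bracket G p w) has_derivative
      (\<lambda>h. 0 + (1/2) *\<^sub>R lie_bracket G h w)) (at 0)" for w
    by (intro has_derivative_add has_derivative_const has_derivative_scaleR_right
        bounded_linear_imp_has_derivative lie_bracket.bounded_linear_left)
  note D = frechet_derivative_at[OF this, symmetric]
  show ?thesis
    unfolding d_left_translation D using lie_bracket_skew[of G v u]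
    by (simp add: scaleR_left_distrib[symmetric])
qed

definition left_metric ::
  "('v::finite, 'e::finite) pre_digraph \<Rightarrow> ('v, 'e) graph_algebra \<Rightarrow>
    ('v, 'e) graph_algebra \<Rightarrow> ('v, 'e) graph_algebra \<Rightarrow> real" where
  "left_metric G p u v =
    inner (d_left_translation G (inv\<^bsub>nil_group G\<^esub> p) p u)
          (d_left_translation G (inv\<^bsub>nil_group G\<^esub> p) p v)"

lemma left_metric_zero: "left_metric G 0 u v = inner u v"
  by (simp add: left_metric_def d_left_translation inv_nil_group lie_bracket.zero_left)

lemma left_metric_invariant:
  "left_metric G (left_translation G a p) (d_left_translation G a p u) (d_left_translation G a p v)
    = left_metric G p u v"
proof -
  have "lie_bracket G (- (a + p + (1/2) *\<^sub>R lie_bracket G a p)) (w + (1/2) *\<^sub>R lie_bracket G a w)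
      = - lie_bracket G a w - lie_bracket G p w" for w
    by (simp only: lie_bracket.minus_left lie_bracket.add_left lie_bracket.add_right
        lie_bracket.scaleR_left lie_bracket.scaleR_right lie_bracket_nested) simp
  then show ?thesis
    by (simp add: left_metric_def d_left_translation inv_nil_group left_translation_def
        mult_nil_group lie_bracket.minus_left scaleR_diff_right)
qed


section \<open>Geodesics of a Riemannian metric in a global chart\<close>

text \<open>
  Christoffel symbols of the first kind of the Levi-Civita connection: by the Koszul formula this
  is \<open>g(\<nabla>\<^sub>U V, W)\<close> at \<open>p\<close>, for the constant vector fields \<open>U\<close>, \<open>V\<close>, \<open>W\<close>.
\<close>

definition christoffel ::
  "('n::euclidean_space \<Rightarrow> 'n \<Rightarrow> 'n \<Rightarrow> real) \<Rightarrow> 'n \<Rightarrow> 'n \<Rightarrow> 'n \<Rightarrow> 'n \<Rightarrow> real" where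
  "christoffel g p u v w =
    (frechet_derivative (\<lambda>q. g q v w) (at p) u
      + frechet_derivative (\<lambda>q. g q u w) (at p) v
      - frechet_derivative (\<lambda>q. g q u v) (at p) w) / 2"

text \<open>The last line of the definition is the vanishing of the covariant acceleration.\<close>

definition geodesic_on ::
  "('n::euclidean_space \<Rightarrow> 'n \<Rightarrow> 'n \<Rightarrow> real) \<Rightarrow> real set \<Rightarrow> (real \<Rightarrow> 'n) \<Rightarrow> bool" where
  "geodesic_on g J \<sigma> \<longleftrightarrow>
    (\<exists>\<sigma>' \<sigma>''. \<forall>t\<in>J.
        (\<sigma> has_vector_derivative \<sigma>' t) (at t)
      \<and> (\<sigma>' has_vector_derivative \<sigma>'' t) (at t)
      \<and> (\<forall>w. g (\<sigma> t) (\<sigma>'' t) w + christoffel g (\<sigma> t) (\<sigma>' t) (\<sigma>' t) w = 0))"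


section \<open>Lattices and the quotient manifold\<close>

definition quotient_topology :: "'a topology \<Rightarrow> ('a \<Rightarrow> 'b) \<Rightarrow> 'b topology" where
  "quotient_topology X f =
    topology (\<lambda>U. U \<subseteq> f ` topspace X \<and> openin X {x \<in> topspace X. f x \<in> U})"

lemma openin_quotient_topology:
  "openin (quotient_topology X f) U \<longleftrightarrow>
    U \<subseteq> f ` topspace X \<and> openin X {x \<in> topspace X. f x \<in> U}"
proof -
  have "istopology (\<lambda>U. U \<subseteq> f ` topspace X \<and> openin X {x \<in> topspace X. f x \<in> U})"
    unfolding istopology_def
  proof (intro conjI allI impI; (elim conjE)?)
    fix S T
    assume "openin X {x \<in> topspace X. f x \<in> S}" "openin X {x \<in> topspace X. f x \<in> T}"
    then have "openin X ({x \<in> topspace X. f x \<in> S} \<inter> {x \<in> topspace X. f x \<in> T})"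
      by (rule openin_Int)
    then show "openin X {x \<in> topspace X. f x \<in> S \<inter> T}"
      by (rule back_subst[where P = "openin X"]) auto
  next
    fix \<K>
    assume "\<forall>K\<in>\<K>. K \<subseteq> f ` topspace X \<and> openin X {x \<in> topspace X. f x \<in> K}"
    then have "openin X (\<Union>K\<in>\<K>. {x \<in> topspace X. f x \<in> K})"
      by blast
    then show "openin X {x \<in> topspace X. f x \<in> \<Union>\<K>}"
      by (rule back_subst[where P = "openin X"]) auto
  qed auto
  then show ?thesis
    by (simp add: quotient_topology_def topology_inverse')
qed

lemma topspace_quotient_topology [simp]: "topspace (quotient_topology X f) = f ` topspace X"
proof
  show "topspace (quotient_topology X f) \<subseteq> f ` topspace X"
    unfolding topspace_def[of "quotient_topology X f"]
    by (auto simp: openin_quotient_topology)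
  have "{x \<in> topspace X. f x \<in> f ` topspace X} = topspace X"
    by auto
  then have "openin (quotient_topology X f) (f ` topspace X)"
    by (simp add: openin_quotient_topology)
  then show "f ` topspace X \<subseteq> topspace (quotient_topology X f)"
    by (rule openin_subset)
qed

lemma quotient_map_quotient_topology: "quotient_map X (quotient_topology X f) f"
  by (auto simp: quotient_map_def openin_quotient_topology)

definition quot_point ::
  "('v::finite, 'e::finite) pre_digraph \<Rightarrow> ('v, 'e) graph_algebra set \<Rightarrow>
    ('v, 'e) graph_algebra \<Rightarrow> ('v, 'e) graph_algebra set" where
  "quot_point G \<Gamma> p = \<Gamma> #>\<^bsub>nil_group G\<^esub> p"

definition nilmanifold ::
  "('v::finite, 'e::finite) pre_digraph \<Rightarrow> ('v, 'e) graph_algebra set \<Rightarrow>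
    ('v, 'e) graph_algebra set topology" where
  "nilmanifold G \<Gamma> = quotient_topology euclidean (quot_point G \<Gamma>)"

definition nil_lattice ::
  "('v::finite, 'e::finite) pre_digraph \<Rightarrow> ('v, 'e) graph_algebra set \<Rightarrow> bool" where
  "nil_lattice G \<Gamma> \<longleftrightarrow>
    subgroup \<Gamma> (nil_group G) \<and> discrete \<Gamma> \<and> compact_space (nilmanifold G \<Gamma>)"

text \<open>
  The tangent bundle of the quotient is the quotient of the tangent bundle \<open>N \<times> \<nn>\<^sub>G\<close> (in the
  global chart) by the derivative of the action of \<open>\<Gamma>\<close>.  A tangent vector of the quotient
  is the orbit of a pair of a base point and a vector there.
\<close>

definition quot_vector ::
  "('v::finite, 'e::finite) pre_digraph \<Rightarrow> ('v, 'e) graph_algebra set \<Rightarrow>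
    ('v, 'e) graph_algebra \<times> ('v, 'e) graph_algebra \<Rightarrow>
    (('v, 'e) graph_algebra \<times> ('v, 'e) graph_algebra) set" where
  "quot_vector G \<Gamma> = (\<lambda>(p, u).
    {(left_translation G \<gamma> p, d_left_translation G \<gamma> p u) | \<gamma>. \<gamma> \<in> \<Gamma>})"

definition tangent_bundle ::
  "('v::finite, 'e::finite) pre_digraph \<Rightarrow> ('v, 'e) graph_algebra set \<Rightarrow>
    (('v, 'e) graph_algebra \<times> ('v, 'e) graph_algebra) set topology" where
  "tangent_bundle G \<Gamma> = quotient_topology euclidean (quot_vector G \<Gamma>)"

text \<open>
  The projection from the group is a local isometry, so a tangent vector of the quotient has
  length one iff its representatives do.
\<close>

definition unit_tangent_bundle ::
  "('v::finite, 'e::finite) pre_digraph \<Rightarrow> ('v, 'e) graph_algebra set \<Rightarrow>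
    (('v, 'e) graph_algebra \<times> ('v, 'e) graph_algebra) set topology" where
  "unit_tangent_bundle G \<Gamma> =
    subtopology (tangent_bundle G \<Gamma>) (quot_vector G \<Gamma> ` {(p, u). left_metric G p u u = 1})"


section \<open>Closed geodesics of the quotient\<close>

text \<open>
  Being a geodesic is a local property preserved by local isometries: a curve in the quotient is
  a geodesic iff it is locally the projection of a geodesic of the group.  Velocities are likewise
  computed from differentiable local lifts.
\<close>

definition quot_geodesic ::
  "('v::finite, 'e::finite) pre_digraph \<Rightarrow> ('v, 'e) graph_algebra set \<Rightarrow>
    (real \<Rightarrow> ('v, 'e) graph_algebra set) \<Rightarrow> bool" where
  "quot_geodesic G \<Gamma> c \<longleftrightarrow>
    (\<forall>t. \<exists>\<epsilon>>0. \<exists>\<sigma>. geodesic_on (left_metric G) {t - \<epsilon><..<t + \<epsilon>} \<sigma>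
        \<and> (\<forall>s\<in>{t - \<epsilon><..<t + \<epsilon>}. c s = quot_point G \<Gamma> (\<sigma> s)))"

definition has_quot_velocity ::
  "('v::finite, 'e::finite) pre_digraph \<Rightarrow> ('v, 'e) graph_algebra set \<Rightarrow>
    (real \<Rightarrow> ('v, 'e) graph_algebra set) \<Rightarrow> real \<Rightarrow>
    (('v, 'e) graph_algebra \<times> ('v, 'e) graph_algebra) set \<Rightarrow> bool" where
  "has_quot_velocity G \<Gamma> c t \<xi> \<longleftrightarrow>
    (\<exists>\<epsilon>>0. \<exists>\<sigma> v. (\<forall>s\<in>{t - \<epsilon><..<t + \<epsilon>}. c s = quot_point G \<Gamma> (\<sigma> s))
        \<and> (\<sigma> has_vector_derivative v) (at t) \<and> \<xi> = quot_vector G \<Gamma> (\<sigma> t, v))"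

text \<open>
  A smoothly closed geodesic is a geodesic on the whole line that is periodic, so that its
  velocities at both ends of a period agree as well.
\<close>

definition smoothly_closed_geodesic ::
  "('v::finite, 'e::finite) pre_digraph \<Rightarrow> ('v, 'e) graph_algebra set \<Rightarrow>
    (real \<Rightarrow> ('v, 'e) graph_algebra set) \<Rightarrow> bool" where
  "smoothly_closed_geodesic G \<Gamma> c \<longleftrightarrow>
    quot_geodesic G \<Gamma> c \<and> (\<exists>\<omega>>0. \<forall>t. c (t + \<omega>) = c t)"

definition density_of_closed_geodesics ::
  "('v::finite, 'e::finite) pre_digraph \<Rightarrow> ('v, 'e) graph_algebra set \<Rightarrow> bool" where
  "density_of_closed_geodesics G \<Gamma> \<longleftrightarrow>
    Abstract_Topology.closure_of (unit_tangent_bundle G \<Gamma>)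
      {\<xi> \<in> topspace (unit_tangent_bundle G \<Gamma>).
        \<exists>c t. smoothly_closed_geodesic G \<Gamma> c \<and> has_quot_velocity G \<Gamma> c t \<xi>}
    = topspace (unit_tangent_bundle G \<Gamma>)"

end

theory Submission
  imports Defs
begin

text \<open>
  Write \<open>\<beta>\<close> for the bracket of the vertex space \<open>\<V>\<close> with values in the arc space
  \<open>\<zz>\<close>, and \<open>j(Z)\<close> for the skew map of \<open>\<V>\<close> dual to it, \<open>\<langle>j(Z) X, Y\<rangle> = \<langle>Z, \<beta>(X, Y)\<rangle>\<close>.
  A geodesic, read back to the identity by left translations, has velocity \<open>(\<xi>(t), Z)\<close> with
  \<open>Z\<close> constant and \<open>\<xi>' = j(Z) \<xi>\<close>.  For a star and for a triangle any two arcs share a vertex,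
  and so every \<open>j(Z)\<close> with \<open>Z \<noteq> 0\<close> has rank two: it rotates a plane with speed \<open>|Z|\<close> and kills the
  orthogonal complement.  Hence \<^emph>\<open>every\<close> geodesic with \<open>Z \<noteq> 0\<close> has periodic velocity, and it is
  carried to itself by one group element \<open>g\<close> that moves it by the time \<open>2\<pi>/|Z|\<close>.  It closes up in
  the quotient as soon as a power of \<open>g\<close> lies in the lattice.

  The element \<open>g\<close> is explicit (\<open>closed_geodesic_through\<close>).  Split the velocity as \<open>X\<^sub>1 + X\<^sub>2\<close> along
  the kernel and the range of \<open>j(Z)\<close>, and let \<open>R\<close> be the point around which the vertex part of the
  geodesic spirals.  Then
  \<open>g = (2\<pi>/|Z|) (X\<^sub>1, (1 + |X\<^sub>2|\<^sup>2 / 2|Z|\<^sup>2) Z + \<beta>(R, X\<^sub>1))\<close>.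
  Take the lattice of points with integral vertex and half-integral arc coordinates.  It remains
  to see that \<open>g\<close> can be made rational by a small change of the initial vector and the base point.
  Call the two components of \<open>g\<close> \<open>a\<close> and \<open>b\<close>, replace them by rational approximations, and solve backwards: \<open>X\<^sub>1\<close> is a multiple of \<open>a\<close>; the direction
  of \<open>Z\<close> is the component \<open>c\<close> of \<open>b\<close> orthogonal to the range of \<open>\<beta>(a, -)\<close>, which is exactly the
  condition \<open>j(Z) X\<^sub>1 = 0\<close>; the length of \<open>c\<close> prescribes \<open>|X\<^sub>2|\<close>; and the remaining component of
  \<open>b\<close> prescribes the bracket with \<open>R\<close> (\<open>periodic_data_exact\<close>).  All of this depends
  continuously on \<open>(a, b)\<close>, because the orthogonal projection onto the range of \<open>\<beta>(a, -)\<close> has the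
  formula \<open>b \<mapsto> \<beta>(a, j(b) a) / |a|\<^sup>2\<close>; this is where the graphs enter a second time
  (\<open>partial_isometry\<close> in \<open>rotation_graph\<close>).
\<close>

section \<open>The bracket of the vertex space and its dual skew maps\<close>

definition vertex_bracket ::
  "('v::finite, 'e::finite) pre_digraph \<Rightarrow> real ^ 'v \<Rightarrow> real ^ 'v \<Rightarrow> real ^ 'e" where
  "vertex_bracket G X Y = (\<chi> e. X $ tail G e * Y $ head G e - X $ head G e * Y $ tail G e)"

text \<open>The usual map \<open>j\<close> of metric two-step nilpotent Lie algebras; its characterization is
  \<open>inner_arc_rotation\<close> below.\<close>

definition arc_rotation ::
  "('v::finite, 'e::finite) pre_digraph \<Rightarrow> real ^ 'e \<Rightarrow> real ^ 'v \<Rightarrow> real ^ 'v" where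
  "arc_rotation G Z X =
    (\<Sum>e\<in>UNIV. Z $ e *\<^sub>R (X $ tail G e *\<^sub>R axis (head G e) 1 - X $ head G e *\<^sub>R axis (tail G e) 1))"

lemma lie_bracket_Pair: "lie_bracket G (X, Z) (Y, W) = (0, vertex_bracket G X Y)"
  by (simp add: lie_bracket_def vertex_bracket_def)

lemma lie_bracket_eq: "lie_bracket G p q = (0, vertex_bracket G (fst p) (fst q))"
  by (simp add: lie_bracket_def vertex_bracket_def)

lemma bounded_bilinear_vertex_bracket: "bounded_bilinear (vertex_bracket G)"
proof -
  have "bilinear (vertex_bracket G)"
    unfolding bilinear_def vertex_bracket_def
    by (auto intro!: linearI simp: vec_eq_iff algebra_simps)
  then show ?thesis
    by (simp add: bilinear_conv_bounded_bilinear)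
qed

interpretation vertex_bracket: bounded_bilinear "vertex_bracket G"
  by (rule bounded_bilinear_vertex_bracket)

lemma bounded_bilinear_arc_rotation: "bounded_bilinear (arc_rotation G)"
proof -
  have "bilinear (arc_rotation G)"
    unfolding bilinear_def arc_rotation_def
    by (auto intro!: linearI sum.cong simp: algebra_simps scaleR_sum_right
        simp flip: sum.distrib)
  then show ?thesis
    by (simp add: bilinear_conv_bounded_bilinear)
qed

interpretation arc_rotation: bounded_bilinear "arc_rotation G"
  by (rule bounded_bilinear_arc_rotation)

lemma vertex_bracket_self [simp]: "vertex_bracket G X X = 0"
  by (simp add: vertex_bracket_def vec_eq_iff)

lemma vertex_bracket_skew: "vertex_bracket G X Y = - vertex_bracket G Y X"
  by (simp add: vertex_bracket_def vec_eq_iff)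

lemma inner_arc_rotation: "arc_rotation G Z X \<bullet> Y = Z \<bullet> vertex_bracket G X Y"
  unfolding arc_rotation_def vertex_bracket_def inner_vec_def[of Z]
  by (auto intro!: sum.cong simp: inner_sum_left inner_diff_left inner_axis' algebra_simps)

section \<open>The geodesic equation\<close>

lemma left_metric_eq:
  "left_metric G p u v
    = (u - (1/2) *\<^sub>R lie_bracket G p u) \<bullet> (v - (1/2) *\<^sub>R lie_bracket G p v)"
  by (simp add: left_metric_def d_left_translation inv_nil_group lie_bracket.minus_left)

lemma christoffel_left_metric:
  "christoffel (left_metric G) p u u w
    = - ((u - (1/2) *\<^sub>R lie_bracket G p u) \<bullet> lie_bracket G u w)"
proof -
  let ?L = "\<lambda>q v. v - (1/2) *\<^sub>R lie_bracket G q v"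
  have "((\<lambda>q. ?L q v \<bullet> ?L q v') has_derivative
      (\<lambda>h. ?L p v \<bullet> (0 - (1/2) *\<^sub>R lie_bracket G h v') + (0 - (1/2) *\<^sub>R lie_bracket G h v) \<bullet> ?L p v')) (at p)"
    for v v'
    by (intro has_derivative_inner has_derivative_diff has_derivative_const has_derivative_scaleR_right
        bounded_linear_imp_has_derivative lie_bracket.bounded_linear_left)
  note D = frechet_derivative_at[OF this, symmetric]
  show ?thesis
    unfolding christoffel_def left_metric_eq D
    using lie_bracket_skew[of G w u]
    by (simp add: inner_commute inner_diff_left inner_diff_right field_simps)
qed

text \<open>
  The hypotheses are the Euler--Arnold equations: in the left invariant frame the velocity is
  \<open>(x', Z)\<close>, its central part is constant, and \<open>j(Z)\<close> drives the rest.
\<close>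

lemma geodesic_onI:
  fixes x x' :: "real \<Rightarrow> real ^ 'v::finite" and z :: "real \<Rightarrow> real ^ 'e::finite"
  assumes x: "\<And>t. (x has_vector_derivative x' t) (at t)"
    and x': "\<And>t. (x' has_vector_derivative arc_rotation G Z (x' t)) (at t)"
    and z: "\<And>t. (z has_vector_derivative Z + (1/2) *\<^sub>R vertex_bracket G (x t) (x' t)) (at t)"
  shows "geodesic_on (left_metric G) J (\<lambda>t. (x t, z t))"
proof -
  have 1: "((\<lambda>t. (x t, z t)) has_vector_derivative
      (x' t, Z + (1/2) *\<^sub>R vertex_bracket G (x t) (x' t))) (at t)" for t
    using x z by (rule has_vector_derivative_Pair)
  have 2: "((\<lambda>t. (x' t, Z + (1/2) *\<^sub>R vertex_bracket G (x t) (x' t))) has_vector_derivative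
      (arc_rotation G Z (x' t), 0 + (1/2) *\<^sub>R (vertex_bracket G (x t) (arc_rotation G Z (x' t))
        + vertex_bracket G (x' t) (x' t)))) (at t)" for t
    by (intro has_vector_derivative_Pair has_vector_derivative_add has_vector_derivative_const
        bounded_linear.has_vector_derivative[OF bounded_linear_scaleR_right]
        vertex_bracket.has_vector_derivative x x')
  have 3: "left_metric G (x t, z t) (arc_rotation G Z (x' t), 0 + (1/2) *\<^sub>R (vertex_bracket G (x t) (arc_rotation G Z (x' t))
        + vertex_bracket G (x' t) (x' t))) w
      + christoffel (left_metric G) (x t, z t)
        (x' t, Z + (1/2) *\<^sub>R vertex_bracket G (x t) (x' t))
        (x' t, Z + (1/2) *\<^sub>R vertex_bracket G (x t) (x' t)) w = 0" for t w
    unfolding christoffel_left_metric left_metric_eq lie_bracket_eq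
    by (cases w) (simp add: inner_Pair inner_arc_rotation inner_diff_right)
  show ?thesis
    unfolding geodesic_on_def
    by (intro exI ballI conjI allI) (rule 1, rule 2, rule 3)
qed


section \<open>Geodesics translated by a lattice element\<close>

text \<open>
  On the plane where \<open>j(Z)\<close> acts as a rotation, \<open>x' = X1 + exp(t j(Z)) X2\<close> integrates to
  \<open>x = R + t X1 + b t\<close> with \<open>b\<close> periodic; the constant of integration \<open>R\<close> is the one for which \<open>b\<close>
  has mean zero, and with this choice \<open>b\<close> enters the element in \<open>mem\<close>, which moves the
  geodesic along itself, only through the constant bracket of \<open>b\<close> with its derivative.
\<close>

lemma closed_geodesic_through:
  fixes G :: "('v::finite, 'e::finite) pre_digraph"
  assumes Z: "Z \<noteq> 0"
    and X1: "arc_rotation G Z X1 = 0"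
    and X2: "arc_rotation G Z (arc_rotation G Z X2) = - (norm Z)\<^sup>2 *\<^sub>R X2"
    and \<Gamma>: "subgroup \<Gamma> (nil_group G)"
    and k: "k > 0" and \<omega>: "\<omega> = 2 * pi * real k / norm Z"
    and mem: "(\<omega> *\<^sub>R X1, \<omega> *\<^sub>R (Z + vertex_bracket G R X1
      + (1 / (2 * (norm Z)\<^sup>2)) *\<^sub>R vertex_bracket G X2 (arc_rotation G Z X2))) \<in> \<Gamma>"
    and p: "p = (R - (1 / (norm Z)\<^sup>2) *\<^sub>R arc_rotation G Z X2, Q)"
  shows "\<exists>c. smoothly_closed_geodesic G \<Gamma> c \<and>
    has_quot_velocity G \<Gamma> c 0 (quot_vector G \<Gamma> (p, d_left_translation G p 0 (X1 + X2, Z)))"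
proof -
  define l where "l = norm Z"
  have l: "l > 0" using Z by (simp add: l_def)
  define Y where "Y = arc_rotation G Z X2"
  define \<beta> where "\<beta> = vertex_bracket G"
  interpret \<beta>: bounded_bilinear \<beta> unfolding \<beta>_def by (rule bounded_bilinear_vertex_bracket)
  have skew: "\<beta> a b = - \<beta> b a" for a b unfolding \<beta>_def by (rule vertex_bracket_skew)
  have self: "\<beta> a a = 0" for a by (simp add: \<beta>_def)
  define b where "b t = (sin (l * t) / l) *\<^sub>R X2 - (cos (l * t) / l\<^sup>2) *\<^sub>R Y" for t
  define b' where "b' t = cos (l * t) *\<^sub>R X2 + (sin (l * t) / l) *\<^sub>R Y" for t
  have b: "(b has_vector_derivative b' t) (at t)" for t
    unfolding b_def b'_def has_vector_derivative_def using l
    by (auto intro!: derivative_eq_intros simp: fun_eq_iff power2_eq_square algebra_simps)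
  have b'1: "(b' has_vector_derivative - l\<^sup>2 *\<^sub>R b t) (at t)" for t
    unfolding b_def b'_def has_vector_derivative_def using l
    by (auto intro!: derivative_eq_intros simp: fun_eq_iff power2_eq_square algebra_simps)
  have Jb': "arc_rotation G Z (b' t) = - l\<^sup>2 *\<^sub>R b t" for t
    unfolding b_def b'_def using l
    by (simp add: arc_rotation.add_right arc_rotation.scaleR_right Y_def X2 l_def[symmetric]
        algebra_simps power2_eq_square)
  have bb': "\<beta> (b t) (b' t) = (1 / l\<^sup>2) *\<^sub>R \<beta> X2 Y" for t
  proof -
    have "\<beta> (b t) (b' t) = ((sin (l * t))\<^sup>2 / l\<^sup>2 + (cos (l * t))\<^sup>2 / l\<^sup>2) *\<^sub>R \<beta> X2 Y"
      unfolding b_def b'_def using skew[of Y X2]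
      by (simp add: \<beta>.add_right \<beta>.diff_left \<beta>.scaleR_right \<beta>.scaleR_left self
          algebra_simps power2_eq_square)
    then show ?thesis
      by (simp flip: add_divide_distrib)
  qed
  have per: "b (t + \<omega>) = b t" "b' (t + \<omega>) = b' t" for t
  proof -
    have "l * (t + \<omega>) = l * t + 2 * pi * real k"
      using l by (simp add: \<omega> l_def[symmetric] field_simps)
    moreover have "sin (l * t + 2 * pi * real k) = sin (l * t)"
      "cos (l * t + 2 * pi * real k) = cos (l * t)"
      using sin_2npi[of k] cos_2npi[of k] by (simp_all add: sin_add cos_add mult.commute mult.left_commute)
    ultimately show "b (t + \<omega>) = b t" "b' (t + \<omega>) = b' t"
      by (simp_all add: b_def b'_def)
  qed
  \<comment> \<open>The constant \<open>S\<close> makes the geodesic start at \<open>p\<close>; \<open>z\<close> is the primitive found by integrating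
    \<open>\<beta> (x t) (x' t)\<close> by parts, where \<open>b' / l\<^sup>2\<close> stands for minus the primitive of \<open>b\<close>.\<close>
  define S where "S = Q - (1/2) *\<^sub>R (\<beta> R (b 0) + (2 / l\<^sup>2) *\<^sub>R \<beta> X1 (b' 0))"
  define x where "x t = R + t *\<^sub>R X1 + b t" for t
  define z where "z t = S + t *\<^sub>R Z + (1/2) *\<^sub>R (t *\<^sub>R \<beta> R X1 + \<beta> R (b t)
    + t *\<^sub>R \<beta> X1 (b t) + (2 / l\<^sup>2) *\<^sub>R \<beta> X1 (b' t) + t *\<^sub>R ((1 / l\<^sup>2) *\<^sub>R \<beta> X2 Y))" for t
  define \<sigma> where "\<sigma> t = (x t, z t)" for t
  have x: "(x has_vector_derivative X1 + b' t) (at t)" for t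
    unfolding x_def using b[of t]
    by (auto intro!: derivative_eq_intros simp: has_vector_derivative_def algebra_simps)
  have x': "((\<lambda>t. X1 + b' t) has_vector_derivative arc_rotation G Z (X1 + b' t)) (at t)" for t
    using b'1[of t] by (auto intro!: derivative_eq_intros simp: arc_rotation.add_right X1 Jb')
  have z: "(z has_vector_derivative Z + (1/2) *\<^sub>R \<beta> (x t) (X1 + b' t)) (at t)" for t
  proof -
    note D = has_vector_derivative_add has_vector_derivative_const
      bounded_linear.has_vector_derivative[OF bounded_linear_scaleR_right]
      bounded_linear.has_vector_derivative[OF \<beta>.bounded_linear_right]
      bounded_linear.has_vector_derivative[OF bounded_linear_scaleR_left]
      bounded_bilinear.has_vector_derivative[OF bounded_bilinear_scaleR] b b'1 has_vector_derivative_id[unfolded id_def]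
    have "(z has_vector_derivative 0 + 1 *\<^sub>R Z + (1/2) *\<^sub>R (1 *\<^sub>R \<beta> R X1 + \<beta> R (b' t)
      + (t *\<^sub>R \<beta> X1 (b' t) + 1 *\<^sub>R \<beta> X1 (b t)) + (2 / l\<^sup>2) *\<^sub>R \<beta> X1 (- l\<^sup>2 *\<^sub>R b t)
      + 1 *\<^sub>R ((1 / l\<^sup>2) *\<^sub>R \<beta> X2 Y))) (at t)"
      unfolding z_def by (intro D)
    moreover have "0 + 1 *\<^sub>R Z + (1/2) *\<^sub>R (1 *\<^sub>R \<beta> R X1 + \<beta> R (b' t)
      + (t *\<^sub>R \<beta> X1 (b' t) + 1 *\<^sub>R \<beta> X1 (b t)) + (2 / l\<^sup>2) *\<^sub>R \<beta> X1 (- l\<^sup>2 *\<^sub>R b t)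
      + 1 *\<^sub>R ((1 / l\<^sup>2) *\<^sub>R \<beta> X2 Y)) = Z + (1/2) *\<^sub>R \<beta> (x t) (X1 + b' t)"
    proof -
      have "(2 / l\<^sup>2) *\<^sub>R \<beta> X1 (- l\<^sup>2 *\<^sub>R b t) = - 2 *\<^sub>R \<beta> X1 (b t)"
        using l by (simp add: \<beta>.scaleR_right \<beta>.minus_right)
      moreover have "2 *\<^sub>R \<beta> X1 (b t) = \<beta> X1 (b t) + \<beta> X1 (b t)"
        by (simp add: scaleR_2)
      ultimately show ?thesis
        using skew[of "b t" X1]
        by (simp add: x_def \<beta>.add_left \<beta>.add_right \<beta>.scaleR_left self bb')
    qed
    ultimately show ?thesis by simp
  qed
  have geo: "geodesic_on (left_metric G) J \<sigma>" for J
    unfolding \<sigma>_def by (rule geodesic_onI[OF x x' z[unfolded \<beta>_def]])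
  define g where "g = (\<omega> *\<^sub>R X1, \<omega> *\<^sub>R (Z + \<beta> R X1 + (1 / (2 * l\<^sup>2)) *\<^sub>R \<beta> X2 Y))"
  have g: "g \<in> \<Gamma>"
    using mem by (simp add: g_def l_def \<beta>_def Y_def)
  have trans: "\<sigma> (t + \<omega>) = g \<otimes>\<^bsub>nil_group G\<^esub> \<sigma> t" for t
  proof -
    have "x (t + \<omega>) = \<omega> *\<^sub>R X1 + x t"
      unfolding x_def per by (simp add: algebra_simps)
    moreover have "z (t + \<omega>) = \<omega> *\<^sub>R (Z + \<beta> R X1 + (1 / (2 * l\<^sup>2)) *\<^sub>R \<beta> X2 Y) + z t
        + (1/2) *\<^sub>R \<beta> (\<omega> *\<^sub>R X1) (x t)"
    proof -
      have "\<beta> X1 R = - \<beta> R X1" by (rule skew)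
      then show ?thesis
        unfolding z_def x_def per using l
        by (simp add: \<beta>.scaleR_left \<beta>.scaleR_right \<beta>.add_right self)
          (simp add: vec_eq_iff field_simps)
    qed
    ultimately show ?thesis
      by (simp add: \<sigma>_def g_def mult_nil_group lie_bracket_Pair \<beta>_def)
  qed
  define c where "c t = quot_point G \<Gamma> (\<sigma> t)" for t
  interpret N: group "nil_group G" by (rule group_nil_group)
  have "c (t + \<omega>) = c t" for t
  proof -
    have "\<Gamma> #>\<^bsub>nil_group G\<^esub> (g \<otimes>\<^bsub>nil_group G\<^esub> \<sigma> t) = (\<Gamma> #>\<^bsub>nil_group G\<^esub> g) #>\<^bsub>nil_group G\<^esub> \<sigma> t"
      using \<Gamma> by (subst N.coset_mult_assoc) (auto simp: nil_group_def)
    also have "\<Gamma> #>\<^bsub>nil_group G\<^esub> g = \<Gamma>"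
      using \<Gamma> g by (subst N.coset_join2) (auto simp: nil_group_def)
    finally show ?thesis
      by (simp add: c_def quot_point_def trans)
  qed
  moreover have "\<omega> > 0"
    using k l by (simp add: \<omega> l_def[symmetric])
  moreover have "quot_geodesic G \<Gamma> c"
    unfolding quot_geodesic_def
  proof
    fix t
    show "\<exists>\<epsilon>>0. \<exists>\<sigma>. geodesic_on (left_metric G) {t - \<epsilon><..<t + \<epsilon>} \<sigma>
        \<and> (\<forall>s\<in>{t - \<epsilon><..<t + \<epsilon>}. c s = quot_point G \<Gamma> (\<sigma> s))"
      by (rule exI[of _ 1], rule conjI, simp, rule exI[of _ \<sigma>]) (simp add: geo c_def)
  qed
  ultimately have "smoothly_closed_geodesic G \<Gamma> c"
    unfolding smoothly_closed_geodesic_def by blast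
  moreover have "has_quot_velocity G \<Gamma> c 0 (quot_vector G \<Gamma> (p, d_left_translation G p 0 (X1 + X2, Z)))"
  proof -
    have 0: "\<sigma> 0 = p"
      by (simp add: \<sigma>_def p x_def z_def S_def b_def Y_def l_def)
    then have "fst p = x 0" by (auto simp: \<sigma>_def)
    moreover have "b' 0 = X2" by (simp add: b'_def)
    ultimately have "(X1 + b' 0, Z + (1/2) *\<^sub>R \<beta> (x 0) (X1 + b' 0)) = d_left_translation G p 0 (X1 + X2, Z)"
      by (simp add: d_left_translation lie_bracket_eq \<beta>_def)
    moreover have "(\<sigma> has_vector_derivative (X1 + b' 0, Z + (1/2) *\<^sub>R \<beta> (x 0) (X1 + b' 0))) (at 0)"
      unfolding \<sigma>_def by (rule has_vector_derivative_Pair[OF x z])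
    ultimately have "(\<sigma> has_vector_derivative d_left_translation G p 0 (X1 + X2, Z)) (at 0)"
      by simp
    then show ?thesis
      unfolding has_quot_velocity_def
    proof (intro exI conjI)
      show "(0 :: real) < 1" by simp
      show "\<forall>s\<in>{0 - 1<..<0 + 1}. c s = quot_point G \<Gamma> (\<sigma> s)" by (simp add: c_def)
      show "quot_vector G \<Gamma> (p, d_left_translation G p 0 (X1 + X2, Z))
          = quot_vector G \<Gamma> (\<sigma> 0, d_left_translation G p 0 (X1 + X2, Z))"
        by (simp add: 0)
    qed
  qed
  ultimately show ?thesis by blast
qed


section \<open>The lattice\<close>

text \<open>
  Arc coordinates are half-integral because the product carries half of a bracket.
\<close>

definition half_integer_lattice :: "('v::finite, 'e::finite) graph_algebra set" where
  "half_integer_lattice = {(x, z). (\<forall>v. x $ v \<in> \<int>) \<and> (\<forall>e. 2 * z $ e \<in> \<int>)}"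

lemma subgroup_half_integer_lattice: "subgroup half_integer_lattice (nil_group G)"
proof
  show "half_integer_lattice \<subseteq> carrier (nil_group G)"
    by (simp add: nil_group_def)
  show "\<one>\<^bsub>nil_group G\<^esub> \<in> half_integer_lattice"
    by (simp add: nil_group_def half_integer_lattice_def zero_prod_def)
  show "x \<otimes>\<^bsub>nil_group G\<^esub> y \<in> half_integer_lattice"
    if "x \<in> half_integer_lattice" "y \<in> half_integer_lattice" for x y
    using that
    by (auto simp: half_integer_lattice_def mult_nil_group lie_bracket_eq vertex_bracket_def
        algebra_simps)
  show "inv\<^bsub>nil_group G\<^esub> x \<in> half_integer_lattice" if "x \<in> half_integer_lattice" for x
    using that by (auto simp: half_integer_lattice_def inv_nil_group)
qed

lemma discrete_half_integer_lattice:
  "discrete (half_integer_lattice :: ('v::finite, 'e::finite) graph_algebra set)"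
proof (rule uniform_discrete_imp_discrete)
  have "p = q" if p: "p \<in> half_integer_lattice" and q: "q \<in> half_integer_lattice"
    and d: "dist p q < 1/2" for p q :: "('v, 'e) graph_algebra"
  proof -
    have eq: "r = s" if "r \<in> \<int>" "s \<in> \<int>" "\<bar>r - s\<bar> < 1" for r s :: real
      using that Ints_eq_abs_less1 by blast
    obtain x z where p': "p = (x, z)" by (cases p)
    obtain y w where q': "q = (y, w)" by (cases q)
    have n: "norm (x - y) < 1/2" "norm (z - w) < 1/2"
      using d norm_fst_le[of "x - y" "z - w"] norm_snd_le[of "z - w" "x - y"]
      by (auto simp: p' q' dist_norm intro: le_less_trans)
    have "x $ v = y $ v" for v
      using p q n(1) component_le_norm_cart[of "x - y" v]
      by (intro eq) (auto simp: half_integer_lattice_def p' q')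
    moreover have "2 * z $ e = 2 * w $ e" for e
      using p q n(2) component_le_norm_cart[of "z - w" e]
      by (intro eq) (auto simp: half_integer_lattice_def p' q')
    ultimately show ?thesis
      by (simp add: p' q' vec_eq_iff)
  qed
  then show "uniform_discrete (half_integer_lattice :: ('v, 'e) graph_algebra set)"
    unfolding uniform_discrete_def by (intro exI[of _ "1/2"]) auto
qed

lemma compact_half_integer_quotient:
  "compact_space (nilmanifold (G :: ('v::finite, 'e::finite) pre_digraph) half_integer_lattice)"
proof -
  let ?\<Gamma> = "half_integer_lattice :: ('v, 'e) graph_algebra set"
  let ?B = "cbox 0 (\<chi> i. 1) \<times> cbox 0 (\<chi> i. 1) :: ('v, 'e) graph_algebra set"
  interpret N: group "nil_group G" by (rule group_nil_group)
  have "\<exists>b\<in>?B. quot_point G ?\<Gamma> p = quot_point G ?\<Gamma> b" for p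
  proof -
    \<comment> \<open>Reduce the vertex coordinates into the unit cube; this shears the arc coordinates, which are
      reduced afterwards.\<close>
    obtain x z where p: "p = (x, z)" by (cases p)
    define m :: "real ^ 'v" where "m = (\<chi> v. - of_int \<lfloor>x $ v\<rfloor>)"
    define y where "y = z + (1/2) *\<^sub>R vertex_bracket G m x"
    define n :: "real ^ 'e" where "n = (\<chi> e. - of_int \<lfloor>y $ e\<rfloor>)"
    have g: "(m, n) \<in> ?\<Gamma>"
      by (simp add: half_integer_lattice_def m_def n_def)
    have "(m, n) \<otimes>\<^bsub>nil_group G\<^esub> p = (m + x, n + y)"
      by (simp add: p mult_nil_group lie_bracket_Pair y_def)
    moreover have "(m + x, n + y) \<in> ?B"
      by (simp add: mem_box_cart m_def n_def) linarith
    moreover have "quot_point G ?\<Gamma> ((m, n) \<otimes>\<^bsub>nil_group G\<^esub> p) = quot_point G ?\<Gamma> p"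
    proof -
      have "?\<Gamma> #>\<^bsub>nil_group G\<^esub> ((m, n) \<otimes>\<^bsub>nil_group G\<^esub> p)
          = (?\<Gamma> #>\<^bsub>nil_group G\<^esub> (m, n)) #>\<^bsub>nil_group G\<^esub> p"
        by (subst N.coset_mult_assoc) (auto simp: nil_group_def)
      also have "?\<Gamma> #>\<^bsub>nil_group G\<^esub> (m, n) = ?\<Gamma>"
        using subgroup_half_integer_lattice g
        by (subst N.coset_join2) (auto simp: nil_group_def)
      finally show ?thesis by (simp add: quot_point_def)
    qed
    ultimately show ?thesis by metis
  qed
  then have "quot_point G ?\<Gamma> ` UNIV = quot_point G ?\<Gamma> ` ?B"
    by blast
  moreover have "compactin (nilmanifold G ?\<Gamma>) (quot_point G ?\<Gamma> ` ?B)"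
  proof (rule image_compactin)
    show "compactin euclidean ?B"
      by (simp add: compact_Times)
    show "continuous_map euclidean (nilmanifold G ?\<Gamma>) (quot_point G ?\<Gamma>)"
      unfolding nilmanifold_def
      by (rule quotient_imp_continuous_map) (rule quotient_map_quotient_topology)
  qed
  ultimately show ?thesis
    by (simp add: compact_space_def nilmanifold_def)
qed

lemma nil_lattice_half_integer_lattice: "nil_lattice G half_integer_lattice"
  by (simp add: nil_lattice_def subgroup_half_integer_lattice discrete_half_integer_lattice
      compact_half_integer_quotient)


section \<open>Initial vectors of closed geodesics\<close>

text \<open>
  The left invariant vector \<open>w\<close> at \<open>p\<close> generates a closed geodesic for the reason given in
  \<open>closed_geodesic_through\<close>, with \<open>k\<close> turns of the rotation.
\<close>

definition periodic_data ::
  "('v::finite, 'e::finite) pre_digraph \<Rightarrow> ('v, 'e) graph_algebra \<Rightarrow> ('v, 'e) graph_algebra \<Rightarrow> bool" where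
  "periodic_data G p w \<longleftrightarrow> (\<exists>R Q X1 X2 Z k. Z \<noteq> 0 \<and> k > 0
    \<and> arc_rotation G Z X1 = 0
    \<and> arc_rotation G Z (arc_rotation G Z X2) = - (norm Z)\<^sup>2 *\<^sub>R X2
    \<and> ((2 * pi * real k / norm Z) *\<^sub>R X1, (2 * pi * real k / norm Z) *\<^sub>R (Z + vertex_bracket G R X1
      + (1 / (2 * (norm Z)\<^sup>2)) *\<^sub>R vertex_bracket G X2 (arc_rotation G Z X2))) \<in> half_integer_lattice
    \<and> p = (R - (1 / (norm Z)\<^sup>2) *\<^sub>R arc_rotation G Z X2, Q)
    \<and> w = (X1 + X2, Z))"

lemma periodic_data_closed:
  assumes "periodic_data G p w"
  shows "\<exists>c. smoothly_closed_geodesic G half_integer_lattice c \<and>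
    has_quot_velocity G half_integer_lattice c 0
      (quot_vector G half_integer_lattice (p, d_left_translation G p 0 w))"
  using assms unfolding periodic_data_def
  by (elim exE conjE, hypsubst)
    (rule closed_geodesic_through[OF _ _ _ subgroup_half_integer_lattice _ refl _ refl])

text \<open>
  Speeding a geodesic up by \<open>s\<close> shortens its period by \<open>s\<close>, and the translating element stays the
  same.  This allows the approximation to be made among vectors of any length.
\<close>

lemma periodic_data_scale:
  assumes "periodic_data G p w" "s > 0"
  shows "periodic_data G p (s *\<^sub>R w)"
proof -
  obtain R Q X1 X2 Z k where *: "Z \<noteq> 0" "k > 0" "arc_rotation G Z X1 = 0"
    "arc_rotation G Z (arc_rotation G Z X2) = - (norm Z)\<^sup>2 *\<^sub>R X2"
    "((2 * pi * real k / norm Z) *\<^sub>R X1, (2 * pi * real k / norm Z) *\<^sub>R (Z + vertex_bracket G R X1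
      + (1 / (2 * (norm Z)\<^sup>2)) *\<^sub>R vertex_bracket G X2 (arc_rotation G Z X2))) \<in> half_integer_lattice"
    "p = (R - (1 / (norm Z)\<^sup>2) *\<^sub>R arc_rotation G Z X2, Q)" "w = (X1 + X2, Z)"
    using assms(1) unfolding periodic_data_def by blast
  have e1: "(2 * pi * real k / norm (s *\<^sub>R Z)) *\<^sub>R s *\<^sub>R X1 = (2 * pi * real k / norm Z) *\<^sub>R X1"
    using assms(2) by simp
  have e2: "(2 * pi * real k / norm (s *\<^sub>R Z)) *\<^sub>R (s *\<^sub>R Z + vertex_bracket G R (s *\<^sub>R X1)
      + (1 / (2 * (norm (s *\<^sub>R Z))\<^sup>2)) *\<^sub>R vertex_bracket G (s *\<^sub>R X2) (arc_rotation G (s *\<^sub>R Z) (s *\<^sub>R X2)))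
    = (2 * pi * real k / norm Z) *\<^sub>R (Z + vertex_bracket G R X1
      + (1 / (2 * (norm Z)\<^sup>2)) *\<^sub>R vertex_bracket G X2 (arc_rotation G Z X2))"
    using assms(2) *(1)
    by (simp add: vertex_bracket.scaleR_left vertex_bracket.scaleR_right arc_rotation.scaleR_left
        arc_rotation.scaleR_right scaleR_add_right power2_eq_square)
  have e3: "(1 / (norm (s *\<^sub>R Z))\<^sup>2) *\<^sub>R arc_rotation G (s *\<^sub>R Z) (s *\<^sub>R X2)
      = (1 / (norm Z)\<^sup>2) *\<^sub>R arc_rotation G Z X2"
    using assms(2) by (simp add: arc_rotation.scaleR_left arc_rotation.scaleR_right power2_eq_square)
  have mem: "((2 * pi * real k / norm (s *\<^sub>R Z)) *\<^sub>R s *\<^sub>R X1,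
      (2 * pi * real k / norm (s *\<^sub>R Z)) *\<^sub>R (s *\<^sub>R Z + vertex_bracket G R (s *\<^sub>R X1)
      + (1 / (2 * (norm (s *\<^sub>R Z))\<^sup>2)) *\<^sub>R vertex_bracket G (s *\<^sub>R X2) (arc_rotation G (s *\<^sub>R Z) (s *\<^sub>R X2))))
      \<in> half_integer_lattice"
    unfolding e1 e2 by (rule *(5))
  have p: "p = (R - (1 / (norm (s *\<^sub>R Z))\<^sup>2) *\<^sub>R arc_rotation G (s *\<^sub>R Z) (s *\<^sub>R X2), Q)"
    unfolding e3 by (rule *(6))
  have "s *\<^sub>R Z \<noteq> 0" "arc_rotation G (s *\<^sub>R Z) (s *\<^sub>R X1) = 0"
    "s *\<^sub>R w = (s *\<^sub>R X1 + s *\<^sub>R X2, s *\<^sub>R Z)"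
    "arc_rotation G (s *\<^sub>R Z) (arc_rotation G (s *\<^sub>R Z) (s *\<^sub>R X2)) = - (norm (s *\<^sub>R Z))\<^sup>2 *\<^sub>R s *\<^sub>R X2"
    using * assms(2)
    by (simp_all add: arc_rotation.scaleR_left arc_rotation.scaleR_right scaleR_add_right power2_eq_square)
  then show ?thesis
    unfolding periodic_data_def using mem p *(2)
    by - (rule exI[of _ R], rule exI[of _ Q], rule exI[of _ "s *\<^sub>R X1"],
        rule exI[of _ "s *\<^sub>R X2"], rule exI[of _ "s *\<^sub>R Z"], rule exI[of _ k], intro conjI)
qed

text \<open>
  Rational approximation that sends zero coordinates to zero exactly, and whose denominator is
  common to all coordinates.
\<close>

lemma floor_quotient_tendsto:
  "(\<lambda>n. (1 / real (Suc n)) *\<^sub>R (\<chi> i. of_int \<lfloor>real (Suc n) * x $ i\<rfloor>)) \<longlonglongrightarrow> (x :: real ^ 'n)"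
proof (rule vec_tendstoI)
  fix i
  have "(\<lambda>n. of_int \<lfloor>real (Suc n) * x $ i\<rfloor> / real (Suc n)) \<longlonglongrightarrow> x $ i"
  proof (rule tendsto_sandwich)
    have "(\<lambda>n. x $ i - inverse (real (Suc n))) \<longlonglongrightarrow> x $ i - 0"
      by (intro tendsto_intros LIMSEQ_inverse_real_of_nat)
    then show "(\<lambda>n. x $ i - inverse (real (Suc n))) \<longlonglongrightarrow> x $ i" by simp
    have "x $ i - inverse (real (Suc n)) \<le> of_int \<lfloor>real (Suc n) * x $ i\<rfloor> / real (Suc n)" for n
    proof -
      have "real (Suc n) * x $ i - 1 \<le> of_int \<lfloor>real (Suc n) * x $ i\<rfloor>" by linarith
      then have "(real (Suc n) * x $ i - 1) / real (Suc n)
          \<le> of_int \<lfloor>real (Suc n) * x $ i\<rfloor> / real (Suc n)"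
        by (rule divide_right_mono) simp
      then show ?thesis by (simp add: diff_divide_distrib inverse_eq_divide)
    qed
    then show "\<forall>\<^sub>F n in sequentially. x $ i - inverse (real (Suc n))
        \<le> of_int \<lfloor>real (Suc n) * x $ i\<rfloor> / real (Suc n)" by simp
    have "of_int \<lfloor>real (Suc n) * x $ i\<rfloor> / real (Suc n) \<le> x $ i" for n
    proof -
      have "of_int \<lfloor>real (Suc n) * x $ i\<rfloor> \<le> real (Suc n) * x $ i" by linarith
      then have "of_int \<lfloor>real (Suc n) * x $ i\<rfloor> / real (Suc n) \<le> real (Suc n) * x $ i / real (Suc n)"
        by (rule divide_right_mono) simp
      then show ?thesis by simp
    qed
    then show "\<forall>\<^sub>F n in sequentially. of_int \<lfloor>real (Suc n) * x $ i\<rfloor> / real (Suc n) \<le> x $ i"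
      by simp
  qed simp
  then show "(\<lambda>n. ((1 / real (Suc n)) *\<^sub>R (\<chi> i. of_int \<lfloor>real (Suc n) * x $ i\<rfloor>)) $ i) \<longlonglongrightarrow> x $ i"
    by simp
qed

section \<open>Density for graphs whose skew maps are rotations of planes\<close>

text \<open>
  The conditions that star and triangle have in common.  The first says that \<open>j(Z)\<close> has no
  eigenvalues besides \<open>0\<close> and \<open>\<plusminus> \<i> |Z|\<close>, the second that the bracket of the plane it rotates is
  the line of \<open>Z\<close>.  The last but one says that \<open>\<beta>(a, -) / |a|\<close> is a partial isometry; for a star
  this is true in general only for \<open>a\<close> without component at the center, and \<open>W\<close> is the set of vertices at
  which \<open>a\<close> is to vanish.  A coordinate subspace has dense rational points, and by \<open>kernel\<close> this
  one contains all the vectors that can be the part \<open>X1\<close> of a velocity.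
\<close>

locale rotation_graph =
  fixes G :: "('v::finite, 'e::finite) pre_digraph" and W :: "'v set"
  assumes rotation: "arc_rotation G Z (arc_rotation G Z (arc_rotation G Z X))
      = - (norm Z)\<^sup>2 *\<^sub>R arc_rotation G Z X"
    and plane: "vertex_bracket G (arc_rotation G Z X) (arc_rotation G Z (arc_rotation G Z X))
      = (norm (arc_rotation G Z X))\<^sup>2 *\<^sub>R Z"
    and kernel: "Z \<noteq> 0 \<Longrightarrow> arc_rotation G Z X = 0 \<Longrightarrow> v \<in> W \<Longrightarrow> X $ v = 0"
    and partial_isometry: "(\<And>v. v \<in> W \<Longrightarrow> a $ v = 0) \<Longrightarrow>
      vertex_bracket G a (arc_rotation G (vertex_bracket G a X) a) = (norm a)\<^sup>2 *\<^sub>R vertex_bracket G a X"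
    and nontrivial: "\<exists>Z X. arc_rotation G Z X \<noteq> 0"
begin

abbreviation \<beta> where "\<beta> \<equiv> vertex_bracket G"
abbreviation j where "j \<equiv> arc_rotation G"

text \<open>
  The orthogonal projection onto the range of \<open>\<beta> a\<close>, whose adjoint is \<open>\<lambda>b. j b a\<close>.  For
  \<open>a = 0\<close> the value is \<open>0\<close>, as it should be.
\<close>

definition range_proj :: "real ^ 'v \<Rightarrow> real ^ 'e \<Rightarrow> real ^ 'e" where
  "range_proj a b = (1 / (norm a)\<^sup>2) *\<^sub>R \<beta> a (j b a)"

lemma range_proj_bracket:
  assumes "\<And>v. v \<in> W \<Longrightarrow> a $ v = 0"
  shows "range_proj a (\<beta> a X) = \<beta> a X"
  by (cases "a = 0") (simp_all add: range_proj_def partial_isometry[OF assms] vertex_bracket.zero_left)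

lemma range_proj_kernel: "j b a = 0 \<Longrightarrow> range_proj a b = 0"
  by (simp add: range_proj_def vertex_bracket.zero_right)

lemma range_proj_diff: "range_proj a (b - c) = range_proj a b - range_proj a c"
  by (simp add: range_proj_def arc_rotation.diff_left vertex_bracket.diff_right scaleR_diff_right)

lemma range_proj_scale: "range_proj a (s *\<^sub>R b) = s *\<^sub>R range_proj a b"
  by (simp add: range_proj_def arc_rotation.scaleR_left vertex_bracket.scaleR_right)

lemma range_proj_range: "range_proj a b = \<beta> a ((1 / (norm a)\<^sup>2) *\<^sub>R j b a)"
  by (simp add: range_proj_def vertex_bracket.scaleR_right)

text \<open>
  What remains after projecting is orthogonal to the range of \<open>\<beta> a\<close>, that is, in the kernel of
  the adjoint \<open>\<lambda>b. j b a\<close>.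
\<close>

lemma kernel_complement:
  assumes a: "\<And>v. v \<in> W \<Longrightarrow> a $ v = 0"
  shows "j (b - range_proj a b) a = 0"
proof (cases "a = 0")
  case False
  have "j (\<beta> a (j b a)) a \<bullet> X = (norm a)\<^sup>2 * (j b a \<bullet> X)" for X
  proof -
    have "j (\<beta> a (j b a)) a \<bullet> X = j (\<beta> a X) a \<bullet> j b a"
      unfolding inner_arc_rotation by (rule inner_commute)
    also have "\<dots> = b \<bullet> \<beta> a (j (\<beta> a X) a)"
      by (subst inner_commute) (rule inner_arc_rotation)
    also have "\<dots> = (norm a)\<^sup>2 * (j b a \<bullet> X)"
      by (simp add: partial_isometry[OF a] inner_arc_rotation)
    finally show ?thesis .
  qed
  then have "j (range_proj a b) a \<bullet> X = j b a \<bullet> X" for X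
    using False by (simp add: range_proj_def arc_rotation.scaleR_left)
  then have "j (range_proj a b) a = j b a"
    using vector_eq_ldot by (metis inner_commute)
  then show ?thesis by (simp add: arc_rotation.diff_left)
qed (simp add: arc_rotation.zero_right)

text \<open>
  Solving backwards: a rational element \<open>(a, b)\<close> is given, and \<open>X1\<close>, \<open>X2\<close>, \<open>Z\<close>, \<open>R'\<close> are made such
  that it translates their geodesic after one turn.  The length \<open>l\<close> of \<open>Z\<close>, the direction \<open>Y\<close> and
  the approximate value \<open>R\<close> are free.  The square root is the solution \<open>|X2|\<close> of
  \<open>2\<pi> (1 + |X2|\<^sup>2 / 2l\<^sup>2) = |c|\<close>, and the correction to \<open>R\<close> is the least one that gives
  \<open>\<beta> a R'\<close> the value \<open>- range_proj a b\<close>.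
\<close>

lemma periodic_data_exact:
  fixes a R Y :: "real ^ 'v" and b Q :: "real ^ 'e" and l :: real
  assumes a: "\<And>v. v \<in> W \<Longrightarrow> a $ v = 0"
    and k: "k > 0" "(real k *\<^sub>R a, real k *\<^sub>R b) \<in> half_integer_lattice"
    and l: "l > 0"
  defines "c \<equiv> b - range_proj a b"
  defines "Z \<equiv> (l / norm c) *\<^sub>R c"
  defines "X2 \<equiv> (sqrt (2 * l\<^sup>2 * (norm c / (2 * pi) - 1)) / norm (j Z Y)) *\<^sub>R j Z Y"
  defines "R' \<equiv> R - (1 / (norm a)\<^sup>2) *\<^sub>R j (range_proj a b + \<beta> a R) a"
  assumes c: "norm c > 2 * pi" and Y: "j Z Y \<noteq> 0"
  shows "periodic_data G (R' - (1 / l\<^sup>2) *\<^sub>R j Z X2, Q) ((l / (2 * pi)) *\<^sub>R a + X2, Z)"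
proof -
  have c0: "norm c > 0" using c pi_gt_zero by linarith
  have nZ: "norm Z = l" using c0 l by (simp add: Z_def)
  have Z0: "Z \<noteq> 0" using nZ l by auto
  have 1: "j Z ((l / (2 * pi)) *\<^sub>R a) = 0"
    unfolding Z_def c_def
    by (simp add: arc_rotation.scaleR_left arc_rotation.scaleR_right kernel_complement[OF a])
  define r where "r = sqrt (2 * l\<^sup>2 * (norm c / (2 * pi) - 1)) / norm (j Z Y)"
  have X2: "X2 = j Z (r *\<^sub>R Y)"
    by (simp add: X2_def r_def arc_rotation.scaleR_right)
  have 2: "j Z (j Z X2) = - (norm Z)\<^sup>2 *\<^sub>R X2"
    unfolding X2 by (rule rotation)
  have n2: "(norm X2)\<^sup>2 = 2 * l\<^sup>2 * (norm c / (2 * pi) - 1)"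
  proof -
    have "norm c / (2 * pi) - 1 \<ge> 0" using c pi_gt_zero by simp
    then show ?thesis using Y by (simp add: X2_def)
  qed
  have "\<beta> X2 (j Z X2) = (norm X2)\<^sup>2 *\<^sub>R Z"
    unfolding X2 by (rule plane)
  then have 3: "Z + (1 / (2 * l\<^sup>2)) *\<^sub>R \<beta> X2 (j Z X2) = (norm c / (2 * pi)) *\<^sub>R Z"
    using l by (simp add: n2 scaleR_left_diff_distrib)
  have "\<beta> a R' = - range_proj a b"
  proof -
    have "range_proj a (range_proj a b + \<beta> a R) = range_proj a b + \<beta> a R"
      unfolding range_proj_range[of a b] vertex_bracket.add_right[symmetric]
      by (rule range_proj_bracket[OF a])
    then show ?thesis
      unfolding R'_def vertex_bracket.diff_right range_proj_range[symmetric] by simp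
  qed
  then have 4: "\<beta> R' ((l / (2 * pi)) *\<^sub>R a) = (l / (2 * pi)) *\<^sub>R range_proj a b"
    using vertex_bracket_skew[of G R' a] by (simp add: vertex_bracket.scaleR_right)
  have 5: "(2 * pi * real k / l) *\<^sub>R (Z + \<beta> R' ((l / (2 * pi)) *\<^sub>R a)
      + (1 / (2 * l\<^sup>2)) *\<^sub>R \<beta> X2 (j Z X2)) = real k *\<^sub>R b"
  proof -
    have "(2 * pi * real k / l) *\<^sub>R ((norm c / (2 * pi)) *\<^sub>R Z) = real k *\<^sub>R c"
      using l c0 by (simp add: Z_def)
    moreover have "(2 * pi * real k / l) *\<^sub>R ((l / (2 * pi)) *\<^sub>R range_proj a b) = real k *\<^sub>R range_proj a b"
      using l by simp
    moreover have "Z + \<beta> R' ((l / (2 * pi)) *\<^sub>R a) + (1 / (2 * l\<^sup>2)) *\<^sub>R \<beta> X2 (j Z X2)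
        = (norm c / (2 * pi)) *\<^sub>R Z + (l / (2 * pi)) *\<^sub>R range_proj a b"
      using 3 4 by (simp add: algebra_simps)
    ultimately show ?thesis
      by (simp only: scaleR_add_right) (simp add: c_def algebra_simps)
  qed
  have 6: "(2 * pi * real k / l) *\<^sub>R ((l / (2 * pi)) *\<^sub>R a) = real k *\<^sub>R a"
    using l by simp
  show ?thesis
    unfolding periodic_data_def
  proof (intro exI conjI)
    show "Z \<noteq> 0" "k > 0" by fact+
    show "j Z ((l / (2 * pi)) *\<^sub>R a) = 0" "j Z (j Z X2) = - (norm Z)\<^sup>2 *\<^sub>R X2" by fact+
    show "((2 * pi * real k / norm Z) *\<^sub>R ((l / (2 * pi)) *\<^sub>R a),
        (2 * pi * real k / norm Z) *\<^sub>R (Z + \<beta> R' ((l / (2 * pi)) *\<^sub>R a)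
          + (1 / (2 * (norm Z)\<^sup>2)) *\<^sub>R \<beta> X2 (j Z X2))) \<in> half_integer_lattice"
      unfolding nZ 5 6 by (rule k(2))
    show "(R' - (1 / l\<^sup>2) *\<^sub>R j Z X2, Q) = (R' - (1 / (norm Z)\<^sup>2) *\<^sub>R j Z X2, Q)"
      by (simp add: nZ)
  qed (rule refl)
qed

text \<open>
  If \<open>j Z X \<noteq> 0\<close>, both the direction of \<open>Z\<close> and that of the rotating part \<open>X2\<close> persist under small
  changes.  Letting the rational \<open>(a, b)\<close> tend to the values of the given geodesic, the vectors
  built from them tend to those of the given geodesic.
\<close>

lemma periodic_data_dense_at:
  fixes P X :: "real ^ 'v" and Q Z :: "real ^ 'e"
  assumes gen: "j Z X \<noteq> 0"
  shows "((P, Q), (X, Z)) \<in> closure {(p, w). periodic_data G p w}"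
proof -
  define l where "l = norm Z"
  have Z: "Z \<noteq> 0" using gen by (auto simp: arc_rotation.zero_left)
  then have l: "l > 0" by (simp add: l_def)
  define X2 where "X2 = - (1 / l\<^sup>2) *\<^sub>R j Z (j Z X)"
  define Y where "Y = - (1 / l\<^sup>2) *\<^sub>R j Z X"
  define X1 where "X1 = X - X2"
  define R where "R = P + (1 / l\<^sup>2) *\<^sub>R j Z X2"
  define a where "a = (2 * pi / l) *\<^sub>R X1"
  define b where "b = (2 * pi / l * (1 + (norm X2)\<^sup>2 / (2 * l\<^sup>2))) *\<^sub>R Z - \<beta> a R"
  have jX2: "j Z X2 = j Z X"
    using l rotation[of Z X]
    by (simp add: X2_def arc_rotation.scaleR_right arc_rotation.minus_right l_def)
  have X2Y: "X2 = j Z Y"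
    by (simp add: X2_def Y_def arc_rotation.scaleR_right arc_rotation.minus_right)
  have X2: "X2 \<noteq> 0" using gen jX2 by (auto simp: arc_rotation.zero_right)
  have jX1: "j Z X1 = 0" by (simp add: X1_def arc_rotation.diff_right jX2)
  then have ja: "j Z a = 0" by (simp add: a_def arc_rotation.scaleR_right)
  have a: "a $ v = 0" if "v \<in> W" for v
    by (rule kernel[OF Z ja that])
  define C where "C = 2 * pi * (1 + (norm X2)\<^sup>2 / (2 * l\<^sup>2))"
  have C: "C > 2 * pi" using X2 l by (simp add: C_def)
  have C0: "C > 0" using C pi_gt_zero by linarith
  have pb: "range_proj a b = - \<beta> a R"
    by (simp add: b_def range_proj_diff range_proj_scale range_proj_kernel[OF ja]
        range_proj_bracket[OF a])
  have cb: "b - range_proj a b = (C / l) *\<^sub>R Z"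
    by (simp add: pb) (simp add: b_def C_def)
  have nc: "norm (b - range_proj a b) = C"
    using l C0 by (simp add: cb l_def)

  define an :: "nat \<Rightarrow> real ^ 'v" where
    "an n = (1 / real (Suc n)) *\<^sub>R (\<chi> i. of_int \<lfloor>real (Suc n) * a $ i\<rfloor>)" for n
  define bn :: "nat \<Rightarrow> real ^ 'e" where
    "bn n = (1 / real (Suc n)) *\<^sub>R (\<chi> i. of_int \<lfloor>real (Suc n) * b $ i\<rfloor>)" for n
  have an: "an \<longlonglongrightarrow> a" and bn: "bn \<longlonglongrightarrow> b"
    unfolding an_def bn_def by (rule floor_quotient_tendsto)+
  have an0: "an n $ v = 0" if "v \<in> W" for n v
    using a[OF that] by (simp add: an_def)
  have lattice: "(real (Suc n) *\<^sub>R an n, real (Suc n) *\<^sub>R bn n) \<in> half_integer_lattice" for n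
    by (simp add: an_def bn_def half_integer_lattice_def del: of_nat_Suc)
  have an_zero: "an n = 0" if "a = 0" for n
    using that by (simp add: an_def vec_eq_iff)
  \<comment> \<open>The division by \<open>|a|\<^sup>2\<close> is continuous along the sequence even for \<open>a = 0\<close>, since then
    \<open>an n = 0\<close> for all \<open>n\<close>.\<close>
  have rot: "(\<lambda>n. (1 / (norm (an n))\<^sup>2) *\<^sub>R j (hn n) (an n)) \<longlonglongrightarrow> (1 / (norm a)\<^sup>2) *\<^sub>R j h a"
    if "hn \<longlonglongrightarrow> h" for hn h
  proof (cases "a = 0")
    case True
    then show ?thesis by (simp add: an_zero)
  next
    case False
    then show ?thesis
      by (intro tendsto_intros an that arc_rotation.tendsto) simp_all
  qed
  define cn where "cn n = bn n - range_proj (an n) (bn n)" for n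
  have pn: "(\<lambda>n. range_proj (an n) (bn n)) \<longlonglongrightarrow> range_proj a b"
    unfolding range_proj_range by (intro vertex_bracket.tendsto an rot bn)
  then have cn: "cn \<longlonglongrightarrow> (C / l) *\<^sub>R Z"
    unfolding cn_def cb[symmetric] by (intro tendsto_intros bn)
  have ncn: "(\<lambda>n. norm (cn n)) \<longlonglongrightarrow> C"
    using tendsto_norm[OF cn] l C0 by (simp add: l_def)
  define Zn where "Zn n = (l / norm (cn n)) *\<^sub>R cn n" for n
  have "(\<lambda>n. (l / norm (cn n)) *\<^sub>R cn n) \<longlonglongrightarrow> (l / C) *\<^sub>R ((C / l) *\<^sub>R Z)"
    using C0 by (intro tendsto_intros cn ncn) simp
  then have Zn: "Zn \<longlonglongrightarrow> Z"
    using C0 l by (simp add: Zn_def[abs_def])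
  have jn: "(\<lambda>n. j (Zn n) Y) \<longlonglongrightarrow> X2"
    unfolding X2Y by (intro arc_rotation.tendsto Zn tendsto_const)
  define X2n where "X2n n = (sqrt (2 * l\<^sup>2 * (norm (cn n) / (2 * pi) - 1)) / norm (j (Zn n) Y)) *\<^sub>R j (Zn n) Y" for n
  have "X2n \<longlonglongrightarrow> (sqrt (2 * l\<^sup>2 * (C / (2 * pi) - 1)) / norm X2) *\<^sub>R X2"
    unfolding X2n_def using X2 by (intro tendsto_intros ncn jn) simp_all
  moreover have "2 * l\<^sup>2 * (C / (2 * pi) - 1) = (norm X2)\<^sup>2"
    using l by (simp add: C_def)
  ultimately have X2n: "X2n \<longlonglongrightarrow> X2"
    using X2 by simp
  define Rn where "Rn n = R - (1 / (norm (an n))\<^sup>2) *\<^sub>R j (range_proj (an n) (bn n) + \<beta> (an n) R) (an n)" for n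
  have "Rn \<longlonglongrightarrow> R - (1 / (norm a)\<^sup>2) *\<^sub>R j (range_proj a b + \<beta> a R) a"
    unfolding Rn_def
    by (intro tendsto_diff rot tendsto_const tendsto_add pn vertex_bracket.tendsto an)
  then have Rn: "Rn \<longlonglongrightarrow> R"
    by (simp add: pb arc_rotation.zero_left)
  define wn where "wn n = ((Rn n - (1 / l\<^sup>2) *\<^sub>R j (Zn n) (X2n n), Q), ((l / (2 * pi)) *\<^sub>R an n + X2n n, Zn n))" for n
  have "wn \<longlonglongrightarrow> ((R - (1 / l\<^sup>2) *\<^sub>R j Z X2, Q), ((l / (2 * pi)) *\<^sub>R a + X2, Z))"
    unfolding wn_def
    by (intro tendsto_intros arc_rotation.tendsto Rn Zn X2n an)
  moreover have "R - (1 / l\<^sup>2) *\<^sub>R j Z X2 = P" "(l / (2 * pi)) *\<^sub>R a + X2 = X"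
    using l by (simp_all add: R_def a_def X1_def)
  ultimately have wn: "wn \<longlonglongrightarrow> ((P, Q), (X, Z))"
    by simp
  have "\<forall>\<^sub>F n in sequentially. norm (cn n) > 2 * pi"
    using ncn C by (rule order_tendstoD)
  moreover have "\<forall>\<^sub>F n in sequentially. j (Zn n) Y \<noteq> 0"
    using jn X2 by (rule tendsto_imp_eventually_ne)
  ultimately have "\<forall>\<^sub>F n in sequentially. wn n \<in> {(p, w). periodic_data G p w}"
  proof eventually_elim
    case (elim n)
    then show ?case
      using periodic_data_exact[of "an n" "Suc n" "bn n" l Y R Q, OF an0 _ lattice l]
      unfolding wn_def X2n_def Rn_def Zn_def cn_def by simp
  qed
  then have "\<forall>\<^sub>F n in sequentially. wn n \<in> closure {(p, w). periodic_data G p w}"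
    by eventually_elim (rule subsetD[OF closure_subset])
  then show ?thesis
    using wn by (intro Lim_in_closed_set[OF closed_closure _ trivial_limit_sequentially])
qed

text \<open>
  A vector with \<open>j Z X = 0\<close> is moved along a line in a direction \<open>(A, B)\<close> with \<open>j B A \<noteq> 0\<close>; on that
  line \<open>j Z X\<close> is a quadratic polynomial with nonzero leading coefficient and has only finitely
  many zeros.
\<close>

lemma periodic_data_dense: "closure {(p, w). periodic_data G p w} = UNIV"
proof -
  have "(p, (X, Z)) \<in> closure {(p, w). periodic_data G p w}" for p X Z
  proof (cases "j Z X = 0")
    case False
    then show ?thesis using periodic_data_dense_at by (cases p) auto
  next
    case True
    obtain B A where AB: "j B A \<noteq> 0" using nontrivial by blast
    define e where "e n = inverse (real (Suc n))" for n
    have e: "e \<longlonglongrightarrow> 0" unfolding e_def by (rule LIMSEQ_inverse_real_of_nat)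
    have e0: "e n \<noteq> 0" for n by (simp add: e_def)
    have exp: "j (Z + e n *\<^sub>R B) (X + e n *\<^sub>R A) = e n *\<^sub>R (j Z A + j B X + e n *\<^sub>R j B A)" for n
      by (simp add: arc_rotation.add_left arc_rotation.add_right arc_rotation.scaleR_left
          arc_rotation.scaleR_right True algebra_simps)
    have "\<forall>\<^sub>F n in sequentially. j Z A + j B X + e n *\<^sub>R j B A \<noteq> 0"
    proof (cases "j Z A + j B X = 0")
      case False
      have "(\<lambda>n. j Z A + j B X + e n *\<^sub>R j B A) \<longlonglongrightarrow> j Z A + j B X + 0 *\<^sub>R j B A"
        by (intro tendsto_intros e)
      with False show ?thesis
        by (intro tendsto_imp_eventually_ne) auto
    qed (simp add: AB e0)
    then have ev: "\<forall>\<^sub>F n in sequentially. (p, (X + e n *\<^sub>R A, Z + e n *\<^sub>R B)) \<in> closure {(p, w). periodic_data G p w}"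
    proof eventually_elim
      case (elim n)
      then have "j (Z + e n *\<^sub>R B) (X + e n *\<^sub>R A) \<noteq> 0"
        using e0 by (simp add: exp)
      then show ?case using periodic_data_dense_at by (cases p) auto
    qed
    have "(\<lambda>n. (p, (X + e n *\<^sub>R A, Z + e n *\<^sub>R B))) \<longlonglongrightarrow> (p, (X + 0 *\<^sub>R A, Z + 0 *\<^sub>R B))"
      by (intro tendsto_intros e)
    then show ?thesis
      using ev by (intro Lim_in_closed_set[OF closed_closure _ trivial_limit_sequentially]) auto
  qed
  then show ?thesis by auto
qed

lemma unit_periodic_data_dense:
  assumes "norm w = 1"
  shows "(p, w) \<in> closure {(p, w). periodic_data G p w \<and> norm w = 1}"
proof -
  have "(p, w) \<in> closure {(p, w). periodic_data G p w}"
    by (simp add: periodic_data_dense)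
  then obtain s where s: "\<And>n. s n \<in> {(p, w). periodic_data G p w}" "s \<longlonglongrightarrow> (p, w)"
    unfolding closure_sequential by blast
  have s2: "(\<lambda>n. snd (s n)) \<longlonglongrightarrow> w" using tendsto_snd[OF s(2)] by simp
  have s1: "(\<lambda>n. fst (s n)) \<longlonglongrightarrow> p" using tendsto_fst[OF s(2)] by simp
  define t where "t n = (fst (s n), (1 / norm (snd (s n))) *\<^sub>R snd (s n))" for n
  have "t n \<in> {(p, w). periodic_data G p w \<and> norm w = 1}" for n
  proof -
    have d: "periodic_data G (fst (s n)) (snd (s n))"
      using s(1)[of n] by auto
    then have "snd (s n) \<noteq> 0" by (auto simp: periodic_data_def zero_prod_def)
    with d show ?thesis by (simp add: t_def periodic_data_scale)
  qed
  moreover have "t \<longlonglongrightarrow> (p, (1 / norm w) *\<^sub>R w)"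
    unfolding t_def using assms by (intro tendsto_intros s1 s2) auto
  ultimately show ?thesis
    unfolding closure_sequential using assms by auto
qed

text \<open>
  The projection from \<open>N \<times> \<nn>\<close>, in the left invariant frame, to the tangent bundle of the quotient is
  continuous, so that density descends.
\<close>

theorem density_half_integer_lattice: "density_of_closed_geodesics G half_integer_lattice"
proof -
  let ?\<Gamma> = "half_integer_lattice :: ('v, 'e) graph_algebra set"
  let ?\<pi> = "quot_vector G ?\<Gamma>"
  let ?U = "{(p, u). left_metric G p u u = 1}"
  let ?A = "{\<xi> \<in> topspace (unit_tangent_bundle G ?\<Gamma>).
        \<exists>c t. smoothly_closed_geodesic G ?\<Gamma> c \<and> has_quot_velocity G ?\<Gamma> c t \<xi>}"
  define \<Phi> where "\<Phi> = (\<lambda>(p, w). (p, w + (1/2) *\<^sub>R lie_bracket G p w))"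
  have d: "d_left_translation G p 0 w = w + (1/2) *\<^sub>R lie_bracket G p w" for p w
    by (rule d_left_translation)
  have unit: "\<Phi> (p, w) \<in> ?U \<longleftrightarrow> norm w = 1" for p w
  proof -
    have "left_metric G p (w + (1/2) *\<^sub>R lie_bracket G p w) (w + (1/2) *\<^sub>R lie_bracket G p w) = w \<bullet> w"
      by (simp add: left_metric_eq lie_bracket.add_right lie_bracket.scaleR_right)
    then show ?thesis by (simp add: \<Phi>_def norm_eq_1)
  qed
  have surj: "\<exists>w. (p, u) = \<Phi> (p, w)" for p u
    by (rule exI[of _ "u - (1/2) *\<^sub>R lie_bracket G p u"])
      (simp add: \<Phi>_def lie_bracket.diff_right lie_bracket.scaleR_right)
  have top: "topspace (unit_tangent_bundle G ?\<Gamma>) = ?\<pi> ` ?U"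
    by (auto simp: unit_tangent_bundle_def tangent_bundle_def)
  have cont: "continuous_map euclidean (tangent_bundle G ?\<Gamma>) (?\<pi> \<circ> \<Phi>)"
  proof (rule continuous_map_compose)
    show "continuous_map euclidean euclidean \<Phi>"
      unfolding \<Phi>_def case_prod_beta
      by (auto intro!: continuous_intros lie_bracket.continuous_on)
    show "continuous_map euclidean (tangent_bundle G ?\<Gamma>) ?\<pi>"
      unfolding tangent_bundle_def
      by (rule quotient_imp_continuous_map) (rule quotient_map_quotient_topology)
  qed
  have closed: "(?\<pi> \<circ> \<Phi>) ` {(p, w). periodic_data G p w \<and> norm w = 1} \<subseteq> ?A"
  proof safe
    fix p w assume pw: "periodic_data G p w" "norm w = 1"
    show "(?\<pi> \<circ> \<Phi>) (p, w) \<in> topspace (unit_tangent_bundle G ?\<Gamma>)"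
      using unit[of p w] pw unfolding top by auto
    show "\<exists>c t. smoothly_closed_geodesic G ?\<Gamma> c \<and> has_quot_velocity G ?\<Gamma> c t ((?\<pi> \<circ> \<Phi>) (p, w))"
      using periodic_data_closed[OF pw(1)] by (auto simp: \<Phi>_def d)
  qed
  have "?\<pi> ` ?U \<subseteq> tangent_bundle G ?\<Gamma> closure_of ?A"
  proof safe
    fix p u assume u: "left_metric G p u u = 1"
    obtain w where w: "(p, u) = \<Phi> (p, w)" using surj by blast
    then have "norm w = 1" using u unit[of p w] by auto
    then have "(p, w) \<in> euclidean closure_of {(p, w). periodic_data G p w \<and> norm w = 1}"
      using unit_periodic_data_dense by simp
    then have "(?\<pi> \<circ> \<Phi>) (p, w) \<in> tangent_bundle G ?\<Gamma> closure_of
        ((?\<pi> \<circ> \<Phi>) ` {(p, w). periodic_data G p w \<and> norm w = 1})"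
      using continuous_map_image_closure_subset[OF cont] by blast
    then have "(?\<pi> \<circ> \<Phi>) (p, w) \<in> tangent_bundle G ?\<Gamma> closure_of ?A"
      using closure_of_mono[OF closed] by blast
    then show "?\<pi> (p, u) \<in> tangent_bundle G ?\<Gamma> closure_of ?A"
      by (simp add: w)
  qed
  moreover have "?A \<subseteq> ?\<pi> ` ?U" by (simp only: top) blast
  ultimately show ?thesis
    unfolding density_of_closed_geodesics_def
    unfolding top unfolding unit_tangent_bundle_def
    by (subst closure_of_subtopology) (auto simp: Int_absorb1 Int_absorb2)
qed

end


section \<open>Stars and triangles\<close>

lemma arc_determined_by_ends:
  assumes "simple_digraph G" "arcs G = UNIV" "{tail G e, head G e} = {tail G f, head G f}"
  shows "e = f"
proof -
  interpret digraph G using assms(1) by (simp add: simple_digraph_def)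
  have ends: "(tail G e, head G e) \<in> arcs_ends G" for e
    using assms(2) by (auto simp: arcs_ends_def arc_to_ends_def)
  consider "tail G e = tail G f" "head G e = head G f" | "tail G e = head G f" "head G e = tail G f"
    using assms(3) by (auto simp: doubleton_eq_iff)
  then show ?thesis
  proof cases
    case 1
    then show ?thesis
      using no_multi_arcs[of e f] assms(2) by (simp add: arc_to_ends_def)
  next
    case 2
    then show ?thesis
      using ends[of e] ends[of f] assms(1) by (auto simp: simple_digraph_def dest: asymD)
  qed
qed

lemma adjacent_mk_symmetric:
  assumes "arcs G = UNIV"
  shows "(u, v) \<in> parcs (mk_symmetric G) \<longleftrightarrow> (\<exists>e. {tail G e, head G e} = {u, v})"
  using assms by (auto simp: parcs_mk_symmetric doubleton_eq_iff)

lemma arc_rotation_nth: "arc_rotation G Z X $ v = (\<Sum>e\<in>UNIV. Z $ e * vertex_bracket G X (axis v 1) $ e)"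
proof -
  have "arc_rotation G Z X $ v = arc_rotation G Z X \<bullet> axis v 1"
    by (simp add: inner_axis)
  then show ?thesis
    unfolding inner_arc_rotation by (simp add: inner_vec_def)
qed

lemma arc_rotation_nontrivial:
  fixes G :: "('v::finite, 'e::finite) pre_digraph"
  assumes "simple_digraph G" "arcs G = UNIV"
  shows "\<exists>Z X. arc_rotation G Z X \<noteq> 0"
proof -
  fix k :: 'e
  have "vertex_bracket G (axis (tail G k) 1) (axis (head G k) 1) = axis k 1"
    using lie_bracket_arc[OF assms, of k] by (simp add: lie_bracket_Pair)
  then have "arc_rotation G (axis k 1) (axis (tail G k) 1) \<bullet> axis (head G k) 1 = 1"
    by (simp add: inner_arc_rotation inner_axis_axis)
  then show ?thesis by (metis inner_zero_left zero_neq_one)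
qed

text \<open>
  With center \<open>c\<close> and after identifying each arc, up to the sign \<open>s\<close>, with its leaf, \<open>j(Z)\<close> is
  the infinitesimal rotation of the plane of \<open>c\<close> and \<open>Z\<close>, and \<open>\<beta>(a, X) = - X\<^sub>c a\<close> for \<open>a\<close> in the span
  of the leaves.
\<close>

lemma rotation_graph_star:
  fixes G :: "('v::finite, 'e::finite) pre_digraph"
  assumes G: "simple_digraph G" "verts G = UNIV" "arcs G = UNIV"
    and star: "complete_bipartite_digraph 1 n (with_proj (mk_symmetric G))"
  shows "\<exists>c. rotation_graph G {c}"
proof -
  obtain U V where UV: "U \<union> V = UNIV" "U \<inter> V = {}" "card U = 1"
    "parcs (mk_symmetric G) = U \<times> V \<union> V \<times> U"
    using star G(2) unfolding complete_bipartite_digraph_def by auto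
  obtain c where U: "U = {c}" using UV(3) card_1_singletonE by blast
  have adj: "(u, v) \<in> parcs (mk_symmetric G) \<longleftrightarrow> (u = c \<and> v \<noteq> c \<or> u \<noteq> c \<and> v = c)" for u v
    using UV U by auto
  have one: "tail G e = c \<and> head G e \<noteq> c \<or> tail G e \<noteq> c \<and> head G e = c" for e
    using adj[of "tail G e" "head G e"] adjacent_mk_symmetric[OF G(3)] by blast
  define leaf where "leaf e = (if tail G e = c then head G e else tail G e)" for e
  define s :: "'e \<Rightarrow> real" where "s e = (if tail G e = c then 1 else - 1)" for e
  have ends: "{tail G e, head G e} = {c, leaf e}" and leafc: "leaf e \<noteq> c" for e
    using one[of e] by (auto simp: leaf_def)
  have inj: "leaf e = leaf f \<longleftrightarrow> e = f" for e f
    using arc_determined_by_ends[OF G(1,3), of e f] ends[of e] ends[of f] by auto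
  have leaf: "\<exists>e. v = leaf e" if "v \<noteq> c" for v
  proof -
    have "(c, v) \<in> parcs (mk_symmetric G)"
      using that by (simp add: adj)
    then obtain e where "{tail G e, head G e} = {c, v}"
      unfolding adjacent_mk_symmetric[OF G(3)] by blast
    then show ?thesis using ends[of e] leafc[of e] that by (metis doubleton_eq_iff)
  qed
  have s2: "s e * s e = 1" "(s e)\<^sup>2 = 1" for e by (simp_all add: s_def)
  have bracket: "vertex_bracket G X Y $ e = s e * (X $ c * Y $ leaf e - X $ leaf e * Y $ c)" for X Y e
    using one[of e] by (auto simp: vertex_bracket_def s_def leaf_def)
  have rot_c: "arc_rotation G Z X $ c = - (\<Sum>e\<in>UNIV. s e * (Z $ e * X $ leaf e))" for Z X
    unfolding arc_rotation_nth using leafc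
    by (auto simp: bracket axis_def sum_negf[symmetric] intro!: sum.cong)
  have rot_leaf: "arc_rotation G Z X $ leaf e = s e * (Z $ e * X $ c)" for Z X e
  proof -
    have "arc_rotation G Z X $ leaf e = (\<Sum>f\<in>UNIV. if f = e then s e * (Z $ e * X $ c) else 0)"
      unfolding arc_rotation_nth using leafc leafc[symmetric]
      by (intro sum.cong) (auto simp: bracket axis_def inj)
    then show ?thesis by simp
  qed
  have vec_eqI: "X = Y" if "X $ c = Y $ c" "\<And>e. X $ leaf e = Y $ leaf e" for X Y :: "real ^ 'v"
    using that leaf by (metis vec_eq_iff)
  have normV: "(norm X)\<^sup>2 = (X $ c)\<^sup>2 + (\<Sum>e\<in>UNIV. (X $ leaf e)\<^sup>2)" for X :: "real ^ 'v"
  proof -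
    have UV: "UNIV = insert c (range leaf)" and c: "c \<notin> range leaf" and l: "inj leaf"
      using leaf leafc inj by (auto simp: inj_def)
    have "(\<Sum>v\<in>UNIV. (X $ v)\<^sup>2) = (X $ c)\<^sup>2 + (\<Sum>e\<in>UNIV. (X $ leaf e)\<^sup>2)"
      unfolding UV using c l by (simp add: sum.reindex)
    then show ?thesis
      unfolding power2_norm_eq_inner inner_vec_def by (simp add: power2_eq_square)
  qed
  have normE: "(norm Z)\<^sup>2 = (\<Sum>e\<in>UNIV. (Z $ e)\<^sup>2)" for Z :: "real ^ 'e"
    unfolding power2_norm_eq_inner inner_vec_def by (simp add: power2_eq_square)
  have rot2_c: "arc_rotation G Z (arc_rotation G Z X) $ c = - (norm Z)\<^sup>2 * X $ c" for Z X
  proof -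
    have "s e * (Z $ e * arc_rotation G Z X $ leaf e) = (Z $ e)\<^sup>2 * X $ c" for e
      using s2(1)[of e] by (simp add: rot_leaf s_def power2_eq_square)
    then show ?thesis by (simp add: rot_c[of Z "arc_rotation G Z X"] normE sum_distrib_right)
  qed
  have "rotation_graph G {c}"
  proof
    fix Z :: "real ^ 'e" and X :: "real ^ 'v"
    show "arc_rotation G Z (arc_rotation G Z (arc_rotation G Z X)) = - (norm Z)\<^sup>2 *\<^sub>R arc_rotation G Z X"
      by (rule vec_eqI) (simp_all add: rot2_c rot_leaf)
    show "vertex_bracket G (arc_rotation G Z X) (arc_rotation G Z (arc_rotation G Z X))
      = (norm (arc_rotation G Z X))\<^sup>2 *\<^sub>R Z"
    proof (rule vec_eq_iff[THEN iffD2, rule_format])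
      fix e
      have "(norm (arc_rotation G Z X))\<^sup>2 = (arc_rotation G Z X $ c)\<^sup>2 + (norm Z)\<^sup>2 * (X $ c)\<^sup>2"
        by (simp add: normV rot_leaf normE power_mult_distrib sum_distrib_right s2)
      then show "vertex_bracket G (arc_rotation G Z X) (arc_rotation G Z (arc_rotation G Z X)) $ e
        = ((norm (arc_rotation G Z X))\<^sup>2 *\<^sub>R Z) $ e"
        by (simp add: bracket rot_leaf rot2_c s_def power2_eq_square algebra_simps)
    qed
    show "X $ v = 0" if Z: "Z \<noteq> 0" and X: "arc_rotation G Z X = 0" and v: "v \<in> {c}" for v
    proof -
      obtain e where "Z $ e \<noteq> 0" using Z by (auto simp: vec_eq_iff)
      then show ?thesis using rot_leaf[of Z X e] X v by (simp add: s_def split: if_splits)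
    qed
    show "vertex_bracket G a (arc_rotation G (vertex_bracket G a X) a) = (norm a)\<^sup>2 *\<^sub>R vertex_bracket G a X"
      if "\<And>v. v \<in> {c} \<Longrightarrow> a $ v = 0" for a
    proof (rule vec_eq_iff[THEN iffD2, rule_format])
      fix e
      have a: "a $ c = 0" using that by simp
      have "s f * (vertex_bracket G a X $ f * a $ leaf f) = - ((a $ leaf f)\<^sup>2 * X $ c)" for f
        by (simp add: bracket a s_def power2_eq_square)
      then have "arc_rotation G (vertex_bracket G a X) a $ c = (norm a)\<^sup>2 * X $ c"
        by (simp add: rot_c normV a sum_negf sum_distrib_right)
      then show "vertex_bracket G a (arc_rotation G (vertex_bracket G a X) a) $ e
        = ((norm a)\<^sup>2 *\<^sub>R vertex_bracket G a X) $ e"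
        by (simp add: bracket a)
    qed
    show "\<exists>Z X. arc_rotation G Z X \<noteq> 0"
      by (rule arc_rotation_nontrivial[OF G(1,3)])
  qed
  then show ?thesis ..
qed

text \<open>
  Numbering each arc like the vertex opposite to it, and up to signs, \<open>\<beta>\<close> is the cross product of
  three-dimensional space and so is \<open>j\<close>; the conditions are identities of the triple product.
\<close>

lemma rotation_graph_triangle:
  fixes G :: "('v::finite, 'e::finite) pre_digraph"
  assumes G: "simple_digraph G" "verts G = UNIV" "arcs G = UNIV"
    and tri: "complete_digraph 3 (with_proj (mk_symmetric G))"
  shows "rotation_graph G {}"
proof -
  have card: "card (UNIV :: 'v set) = 3"
    and adj: "(u, v) \<in> parcs (mk_symmetric G) \<longleftrightarrow> u \<noteq> v" for u v
    using tri G(2) unfolding complete_digraph_def by auto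
  obtain x y z :: 'v where UV: "UNIV = {x, y, z}" and d: "x \<noteq> y" "y \<noteq> z" "z \<noteq> x"
    using card unfolding card_3_iff by (elim exE conjE, intro that) (assumption | erule not_sym)+
  have V: "v = x \<or> v = y \<or> v = z" for v
  proof -
    have "v \<in> UNIV" by (rule UNIV_I)
    then show ?thesis unfolding UV by simp
  qed
  have ex: "\<exists>e. {tail G e, head G e} = {u, v}" if "u \<noteq> v" for u v
    using that adj adjacent_mk_symmetric[OF G(3)] by blast
  obtain e1 e2 e3 where e: "{tail G e1, head G e1} = {y, z}" "{tail G e2, head G e2} = {z, x}"
    "{tail G e3, head G e3} = {x, y}"
    using ex d by metis
  have uniq: "e = f" if "{tail G e, head G e} = {tail G f, head G f}" for e f
    using arc_determined_by_ends[OF G(1,3) that] .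
  have E: "f = e1 \<or> f = e2 \<or> f = e3" for f
  proof -
    have "tail G f \<noteq> head G f"
      using adj[of "tail G f" "head G f"] adjacent_mk_symmetric[OF G(3)] by blast
    then have "{tail G f, head G f} \<in> {{y, z}, {z, x}, {x, y}}"
      using V[of "tail G f"] V[of "head G f"] by auto
    then show ?thesis using uniq e by auto
  qed
  then have UE: "UNIV = {e1, e2, e3}" by blast
  have de: "e1 \<noteq> e2" "e2 \<noteq> e3" "e3 \<noteq> e1"
    using e d by (auto simp: doubleton_eq_iff)
  define s :: "'e \<Rightarrow> real" where
    "s e = (if (tail G e, head G e) \<in> {(y, z), (z, x), (x, y)} then 1 else - 1)" for e
  have s: "s e = 1 \<or> s e = - 1" for e by (simp add: s_def)
  have bracket:
    "vertex_bracket G X Y $ e1 = s e1 * (X $ y * Y $ z - X $ z * Y $ y)"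
    "vertex_bracket G X Y $ e2 = s e2 * (X $ z * Y $ x - X $ x * Y $ z)"
    "vertex_bracket G X Y $ e3 = s e3 * (X $ x * Y $ y - X $ y * Y $ x)" for X Y
    using e d by (auto simp: vertex_bracket_def s_def doubleton_eq_iff)
  have sumE: "(\<Sum>e\<in>UNIV. f e) = f e1 + f e2 + f e3" for f :: "'e \<Rightarrow> real"
    unfolding UE using de by simp
  have sumV: "(\<Sum>v\<in>UNIV. f v) = f x + f y + f z" for f :: "'v \<Rightarrow> real"
    unfolding UV using d by simp
  have rot:
    "arc_rotation G Z X $ x = s e2 * (Z $ e2 * X $ z) - s e3 * (Z $ e3 * X $ y)"
    "arc_rotation G Z X $ y = s e3 * (Z $ e3 * X $ x) - s e1 * (Z $ e1 * X $ z)"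
    "arc_rotation G Z X $ z = s e1 * (Z $ e1 * X $ y) - s e2 * (Z $ e2 * X $ x)" for Z X
    unfolding arc_rotation_nth sumE bracket using d by (auto simp: axis_def)
  have normV: "(norm X)\<^sup>2 = (X $ x)\<^sup>2 + (X $ y)\<^sup>2 + (X $ z)\<^sup>2" for X :: "real ^ 'v"
    unfolding power2_norm_eq_inner inner_vec_def sumV by (simp add: power2_eq_square)
  have normE: "(norm Z)\<^sup>2 = (Z $ e1)\<^sup>2 + (Z $ e2)\<^sup>2 + (Z $ e3)\<^sup>2" for Z :: "real ^ 'e"
    unfolding power2_norm_eq_inner inner_vec_def sumE by (simp add: power2_eq_square)
  have eqV: "X = Y \<longleftrightarrow> X $ x = Y $ x \<and> X $ y = Y $ y \<and> X $ z = Y $ z" for X Y :: "real ^ 'v"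
    unfolding vec_eq_iff using V by metis
  have eqE: "Z = Y \<longleftrightarrow> Z $ e1 = Y $ e1 \<and> Z $ e2 = Y $ e2 \<and> Z $ e3 = Y $ e3" for Z Y :: "real ^ 'e"
    unfolding vec_eq_iff using E by metis
  show ?thesis
  proof
    fix Z :: "real ^ 'e" and X :: "real ^ 'v"
    show "arc_rotation G Z (arc_rotation G Z (arc_rotation G Z X)) = - (norm Z)\<^sup>2 *\<^sub>R arc_rotation G Z X"
      using s[of e1] s[of e2] s[of e3]
      unfolding eqV vector_scaleR_component rot normE real_scaleR_def
      by (elim disjE) (simp add: power2_eq_square algebra_simps)+
    show "vertex_bracket G (arc_rotation G Z X) (arc_rotation G Z (arc_rotation G Z X))
      = (norm (arc_rotation G Z X))\<^sup>2 *\<^sub>R Z"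
      using s[of e1] s[of e2] s[of e3]
      unfolding eqE vector_scaleR_component bracket rot normV real_scaleR_def bracket
      by (elim disjE) (simp add: power2_eq_square algebra_simps)+
    show "vertex_bracket G a (arc_rotation G (vertex_bracket G a X) a) = (norm a)\<^sup>2 *\<^sub>R vertex_bracket G a X" for a
      using s[of e1] s[of e2] s[of e3]
      unfolding eqE vector_scaleR_component bracket rot normV real_scaleR_def bracket
      by (elim disjE) (simp add: power2_eq_square algebra_simps)+
    show "\<exists>Z X. arc_rotation G Z X \<noteq> 0"
      by (rule arc_rotation_nontrivial[OF G(1,3)])
  qed simp
qed

theorem mainTheorem4:
  fixes G :: "('v::finite, 'e::finite) pre_digraph"
  assumes "simple_digraph G"
    and "verts G = UNIV" and "arcs G = UNIV"
    and "(\<exists>n\<ge>1. complete_bipartite_digraph 1 n (with_proj (mk_symmetric G)))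
       \<or> complete_digraph 3 (with_proj (mk_symmetric G))"
  shows "\<exists>\<Gamma>. nil_lattice G \<Gamma> \<and> density_of_closed_geodesics G \<Gamma>"
proof -
  obtain W where "rotation_graph G W"
    using assms(4) rotation_graph_star[OF assms(1-3)] rotation_graph_triangle[OF assms(1-3)] by blast
  then have "density_of_closed_geodesics G half_integer_lattice"
    by (rule rotation_graph.density_half_integer_lattice)
  then show ?thesis
    using nil_lattice_half_integer_lattice by blast
qed

end
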